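(* Let $q$ be an odd prime power, let $n\ge1$ and $r\ge1$, and let $\psi\in\{+,-\}$. Then $$\begin{aligned}\mathrm{sym}_0^{\psi}(n+1,r+1)={}&(q^n-q^{r-1})\,\mathrm{sym}_0^{\psi\cdot\psi(-1)}(n,r-1)+\mathrm{sq}^{\psi}(r+1)\,\mathrm{sym}_0^{\psi}(n,r+1)\\&+\frac12\bigl(\mathrm{sq}^{\psi}(r+1)-\mathrm{sq}^{\psi}(r)\bigr)\,\mathrm{sym}_0^{\psi}(n,r)\\&+\left(q^r-\frac12\bigl(\mathrm{sq}^{-\psi}(r+1)+\mathrm{sq}^{-\psi}(r)\bigr)\right)\mathrm{sym}_0^{-\psi}(n,r).\end{aligned}$$
   Context: $\mathbf{F}_q$ is the field with $q$ elements. For $\delta\in\mathbf{F}_q^\times$, $\psi(\delta)=+$ if $\delta$ is a square in $\mathbf{F}_q$ and $\psi(\delta)=-$ otherwise; signs are multiplied as $\pm1$. Every symmetric $n\times n$ matrix $A$ over $\mathbf{F}_q$ of rank $r>0$ can be written as $A=M\cdot\mathrm{diag}(1^{r-1},\delta,0^{n-r})\cdot M^T$ with $M\in\mathbf{GL}(n,q)$ and $\delta\in\mathbf{F}_q^\times$ either $1$ or a non-square; the (quadratic) character of $A$ is $\psi(A)=+$ if $\delta=1$ and $\psi(A)=-$ if $\delta$ is a non-square. By convention the zero matrix has character $+$. $\mathrm{sym}_0^{\psi}(n,r)$ is the number of $n\times n$ symmetric matrices over $\mathbf{F}_q$ of rank $r$, with all diagonal entries equal to zero, and with character $\psi$. For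 $m\ge1$, $\mathrm{sq}^{+}(m)$ is the number of solutions in $\mathbf{F}_q^m$ of $\sum_{i=1}^m x_i^2=0$, and $\mathrm{sq}^{-}(m)$ is the number of solutions in $\mathbf{F}_q^m$ of $\sum_{i=1}^{m-1}x_i^2+zx_m^2=0$, where $z$ is a fixed non-square in $\mathbf{F}_q$ (the number does not depend on the choice of $z$). *)

theory Defs
  imports "Jordan_Normal_Form.DL_Rank" "HOL-Library.Cardinality"
begin

text \<open>
  The field with $q$ elements is a type \<open>'a\<close> of class \<open>field\<close> and \<open>finite\<close> with
  $q$ = \<open>CARD('a)\<close>.  Signs are the integers \<open>1\<close> and \<open>-1\<close>.
\<close>

definition is_sq :: "'a::field \<Rightarrow> bool" where
  "is_sq d \<longleftrightarrow> (\<exists>x. d = x ^ 2)"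

definition psi :: "'a::field \<Rightarrow> int" where
  "psi d = (if is_sq d then 1 else - 1)"

definition diag_normal_form :: "nat \<Rightarrow> nat \<Rightarrow> 'a::field \<Rightarrow> 'a mat" where
  "diag_normal_form n r d =
     mat_diag n (\<lambda>i. if i + 1 < r then 1 else if i + 1 = r then d else 0)"

text \<open>
  The character of a symmetric matrix as a relation: \<open>has_character n A s\<close> says that the
  $n \times n$ matrix \<open>A\<close> has character \<open>s\<close>.  In odd characteristic every symmetric matrix
  stands in this relation to exactly one sign.
\<close>

definition has_character :: "nat \<Rightarrow> 'a::field mat \<Rightarrow> int \<Rightarrow> bool" where
  "has_character n A s \<longleftrightarrow>
     (if A = 0\<^sub>m n n then s = 1
      else \<exists>M d. M \<in> carrier_mat n n \<and> invertible_mat M \<and>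
             (d = 1 \<or> \<not> is_sq d) \<and>
             A = M * diag_normal_form n (vec_space.rank n A) d * transpose_mat M \<and>
             s = psi d)"

definition sym0 :: "'a::{field,finite} itself \<Rightarrow> int \<Rightarrow> nat \<Rightarrow> nat \<Rightarrow> nat" where
  "sym0 _ s n r =
     card {A :: 'a mat. A \<in> carrier_mat n n \<and> transpose_mat A = A \<and>
             vec_space.rank n A = r \<and> (\<forall>i<n. A $$ (i, i) = 0) \<and> has_character n A s}"

text \<open>
  Here \<open>z\<close> is the chosen non-square; it is not used when \<open>s = 1\<close>.  Coordinates are numbered
  from 0, so the last one is \<open>m - 1\<close>; only \<open>m \<ge> 1\<close> is meaningful.
\<close>

definition sq :: "'a::{field,finite} \<Rightarrow> int \<Rightarrow> nat \<Rightarrow> nat" where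
  "sq z s m =
     card {x :: 'a vec. x \<in> carrier_vec m \<and>
             (\<Sum>i<m - 1. (x $ i) ^ 2) + (if s = 1 then 1 else z) * (x $ (m - 1)) ^ 2 = 0}"

end

theory Submission
  imports Defs "Berlekamp_Zassenhaus.Berlekamp_Type_Based" "HOL-Number_Theory.Residues"
begin

text \<open>
  Remove the last row and column of a symmetric matrix with zero diagonal of size \<open>n + 1\<close>. What remains is a matrix
  \<open>B\<close> of the same kind of size \<open>n\<close> and a vector \<open>v\<close>, the removed column, and every pair \<open>(B, v)\<close> occurs
  once. So the recursion follows once it is known, for each \<open>B\<close>, how many \<open>v\<close> lead to rank \<open>r + 1\<close> and
  character \<open>s\<close>.

  Regard the matrices as Gram matrices of quadratic forms. If \<open>v\<close> is not in the column space of \<open>B\<close>, the bordered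
  form is the sum of \<open>B\<close> and a hyperbolic plane: the rank grows by 2 and the character is multiplied by that of
  \<open>-1\<close> (\<open>rank_char_border_outside\<close>). If \<open>v = B *\<^sub>v w\<close>, subtracting \<open>w\<close> from the new basis vector
  makes it orthogonal to the old space, and its length becomes \<open>- w \<bullet> (B *\<^sub>v w)\<close>: the rank grows by 1 if this is
  nonzero, and then the character is multiplied by that of this number; otherwise rank and character stay the same
  (\<open>rank_char_border_inside\<close>).

  In coordinates \<open>x\<close> that diagonalise \<open>B\<close>, the value \<open>w \<bullet> (B *\<^sub>v w)\<close> is the sum of squares
  \<open>x\<^sub>1\<^sup>2 + \<dots> + d * x\<^sub>k\<^sup>2\<close>, whose zeros are counted by \<open>sq\<close>. The number of vectors where minus this sum
  is a nonzero square is half the number of those zeros of the form with one more square for which the added coordinate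
  is nonzero; by complement this also gives the number of vectors where it is a nonsquare. This yields the
  four coefficients (\<open>card_hollow_extensions\<close>).

  For the count to make sense every matrix involved must have exactly one rank and character. Uniqueness holds since the
  rank is determined by the size of the image (\<open>rank_congruent\<close>) and the discriminant of the nonzero part is
  determined up to squares (\<open>psi_congruent_normal\<close>). Existence follows from the same analysis of borders by induction
  on the size (\<open>hollow_sym_rank_char_exists\<close>). That each diagonal matrix has the normal form
  \<open>diag(1, \<dots>, 1, d, 0, \<dots>, 0)\<close> rests on the fact that every form \<open>a * x\<^sup>2 + b * y\<^sup>2\<close> with nonzero coefficients
  over a finite field of odd order represents 1.
\<close>

section \<open>Rank as the size of the image\<close>

text \<open>
  Gives the column space a matrix whose columns form a basis, so that its elements can be counted by their coordinates.
\<close>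

lemma (in vec_space) rank_basis_matrix:
  assumes A: "A \<in> carrier_mat n nc"
  shows "\<exists>B \<in> carrier_mat n (rank A). distinct (cols B) \<and> lin_indpt (set (cols B))
           \<and> col_space B = col_space A"
proof -
  have S: "set (cols A) \<subseteq> carrier_vec n" using cols_dim A by blast
  interpret W: vectorspace class_ring "span_vs (set (cols A))"
    using S span_is_subspace subspace_is_vs by simp
  obtain \<beta> where fin: "finite \<beta>" and bas: "W.basis \<beta>"
    using W.finite_basis_exists fin_dim_span_cols[OF A] by blast
  have sub: "\<beta> \<subseteq> span (set (cols A))" and li: "W.lin_indpt \<beta>"
    and gen: "LinearCombinations.module.span class_ring (span_vs (set (cols A))) \<beta> = span (set (cols A))"
    using bas unfolding W.basis_def by auto
  have subm: "submodule class_ring (span (set (cols A))) V" using S span_is_submodule by simp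
  have li': "lin_indpt \<beta>" using li span_li_not_depend(2)[OF sub subm] by simp
  have gen': "span \<beta> = span (set (cols A))" using gen span_li_not_depend(1)[OF sub subm] by simp
  have card: "card \<beta> = rank A" unfolding rank_def using W.dim_basis[OF fin bas] by simp
  obtain bs where bs: "set bs = \<beta>" "distinct bs" using finite_distinct_list[OF fin] by blast
  have len: "length bs = rank A" using bs card distinct_card by metis
  have "set bs \<subseteq> carrier_vec n" using sub bs S span_is_subset2 by auto
  then have c: "cols (mat_of_cols n bs) = bs" by simp
  show ?thesis
    by (rule bexI[of _ "mat_of_cols n bs"])
      (use c bs li' gen' len mat_of_cols_carrier(1)[of n bs] in \<open>auto simp: col_space_def\<close>)
qed

lemma (in vec_space) lin_indpt_cols_inj:
  assumes B: "B \<in> carrier_mat n k" and "distinct (cols B)" "lin_indpt (set (cols B))"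
  shows "inj_on (\<lambda>x. B *\<^sub>v x) (carrier_vec k)"
proof (rule inj_onI)
  fix x y assume x: "x \<in> carrier_vec k" and y: "y \<in> carrier_vec k" and eq: "B *\<^sub>v x = B *\<^sub>v y"
  have "B *\<^sub>v (x - y) = 0\<^sub>v n" using mult_minus_distrib_mat_vec[OF B x y] eq B x y by simp
  then have "x - y = 0\<^sub>v k" using lin_depI[OF B, of "x - y"] assms x y by fastforce
  then have "x $ i - y $ i = 0" if "i < k" for i
    using that x y by (metis carrier_vecD index_minus_vec(1) index_zero_vec(1))
  then show "x = y" using x y by (intro eq_vecI) auto
qed

text \<open>
  Over a finite field the number of vectors in the column space determines the rank. This turns every rank
  computation below into the computation of an image.
\<close>

lemma card_image_mat_rank:
  fixes A :: "'a::{field,finite} mat"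
  assumes A: "A \<in> carrier_mat n nc"
  shows "card ((\<lambda>x. A *\<^sub>v x) ` carrier_vec nc) = CARD('a) ^ vec_space.rank n A"
proof -
  interpret vec_space "TYPE('a)" n .
  have im: "(\<lambda>x. C *\<^sub>v x) ` carrier_vec k = col_space C" if "C \<in> carrier_mat n k" for C k
    using that unfolding col_space_eq[OF that] by auto
  from rank_basis_matrix[OF A] obtain B where B: "B \<in> carrier_mat n (rank A)"
    "distinct (cols B)" "lin_indpt (set (cols B))" "col_space B = col_space A" by blast
  then show ?thesis
    using im[OF A] im[OF B(1)] card_image[OF lin_indpt_cols_inj[OF B(1-3)]]
    by (simp add: card_carrier_vec)
qed

section \<open>Squares in finite fields of odd order\<close>

lemma two_neq_0_field:
  assumes "odd CARD('a::{field,finite})"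
  shows "(2::'a) \<noteq> 0"
proof
  assume "(2::'a) = 0"
  then have "of_nat 2 = (0::'a)" by simp
  then have "CHAR('a) dvd 2" by (simp only: of_nat_eq_0_iff_char_dvd)
  moreover have "CHAR('a) \<noteq> 1" by simp
  ultimately have "CHAR('a) = 2" using prime_nat_iff two_is_prime_nat by blast
  then show False using CHAR_dvd_CARD[where 'a = 'a] assms by simp
qed

lemma card_square_roots:
  fixes a :: "'a::{field,finite}"
  assumes "odd CARD('a)"
  shows "card {x. x ^ 2 = a} = (if a = 0 then 1 else if is_sq a then 2 else 0)"
proof (cases "is_sq a")
  case True
  then obtain t where t: "a = t ^ 2" unfolding is_sq_def by blast
  have "{x. x ^ 2 = a} = {t, - t}" using t by (auto simp: power2_eq_iff)
  moreover have "t \<noteq> - t" if "t \<noteq> 0"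
    using that two_neq_0_field[OF assms] by (metis add_eq_0_iff mult_2 mult_eq_0_iff)
  ultimately show ?thesis using t True by (auto simp: card_insert_if)
next
  case False
  then have "a \<noteq> 0" "{x. x ^ 2 = a} = {}" unfolding is_sq_def by (auto intro: exI[of _ 0])
  then show ?thesis using False by simp
qed

text \<open>
  Squaring is two-to-one on the nonzero elements, because \<open>x \<noteq> - x\<close> there.
\<close>

lemma card_nonzero_squares:
  assumes "odd CARD('a::{field,finite})"
  shows "2 * card {a :: 'a. a \<noteq> 0 \<and> is_sq a} + 1 = CARD('a)"
proof -
  let ?S = "{a :: 'a. a \<noteq> 0 \<and> is_sq a}" and ?N = "UNIV - {0 :: 'a}"
  have "card {x \<in> ?N. x ^ 2 = a} = 2" if "a \<in> ?S" for a
  proof -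
    have "{x \<in> ?N. x ^ 2 = a} = {x. x ^ 2 = a}" using that by auto
    then show ?thesis using that card_square_roots[OF assms, of a] by simp
  qed
  then have "(\<Sum>x\<in>?N. card {a \<in> ?S. x ^ 2 = a}) = 2 * card ?S"
    by (intro sum_multicount) auto
  moreover have "{a \<in> ?S. x ^ 2 = a} = {x ^ 2}" if "x \<in> ?N" for x
    using that by (auto simp: is_sq_def)
  ultimately have "card ?N = 2 * card ?S" by simp
  moreover have "card ?N + 1 = CARD('a)" by (simp add: card_Diff_singleton)
  ultimately show ?thesis by simp
qed

lemma is_sq_mult_square_iff:
  fixes a t :: "'a::field"
  assumes "t \<noteq> 0"
  shows "is_sq (a * t ^ 2) \<longleftrightarrow> is_sq a"
proof
  assume "is_sq (a * t ^ 2)"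
  then obtain x where "a * t ^ 2 = x ^ 2" unfolding is_sq_def by blast
  then have "a = (x / t) ^ 2" using assms by (simp add: field_simps)
  then show "is_sq a" unfolding is_sq_def by blast
next
  assume "is_sq a"
  then show "is_sq (a * t ^ 2)" unfolding is_sq_def by (metis power_mult_distrib)
qed

lemma psi_mult_square:
  fixes a t :: "'a::field"
  assumes "t \<noteq> 0"
  shows "psi (a * t ^ 2) = psi a"
  using is_sq_mult_square_iff[OF assms] by (simp add: psi_def)

lemma psi_one [simp]: "psi (1 :: 'a::field) = 1"
  by (auto simp: psi_def is_sq_def intro: exI[of _ 1])

lemma is_sq_0 [simp]: "is_sq (0 :: 'a::field)"
  by (auto simp: is_sq_def intro: exI[of _ 0])

lemma psi_square: "psi (t ^ 2 :: 'a::field) = 1"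
  by (auto simp: psi_def is_sq_def)

lemma psi_cases: "psi a = 1 \<or> psi a = - 1"
  by (simp add: psi_def)

text \<open>
  Multiplication by a nonsquare \<open>a\<close> maps the nonzero squares injectively into the nonsquares. There are
  equally many of both, so \<open>b\<close> has the form \<open>a * t\<^sup>2\<close>.
\<close>

lemma is_sq_mult_nonsquares:
  fixes a b :: "'a::{field,finite}"
  assumes odd: "odd CARD('a)" and a: "\<not> is_sq a" and b: "\<not> is_sq b"
  shows "is_sq (a * b)"
proof -
  let ?S = "{c :: 'a. c \<noteq> 0 \<and> is_sq c}" and ?T = "{c :: 'a. \<not> is_sq c}"
  have a0: "a \<noteq> 0" using a by auto
  have "a * c \<in> ?T" if "c \<in> ?S" for c
    using that a is_sq_mult_square_iff[of _ a] unfolding is_sq_def by fastforce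
  moreover have "card ?S = card ?T"
  proof -
    have "UNIV = insert (0::'a) (?S \<union> ?T)" by auto
    moreover have "card (insert (0::'a) (?S \<union> ?T)) = Suc (card ?S + card ?T)"
      by (subst card_insert_disjoint) (auto intro!: card_Un_disjoint)
    ultimately have "CARD('a) = Suc (card ?S + card ?T)" by simp
    then show ?thesis using card_nonzero_squares[OF odd] by simp
  qed
  moreover have "inj_on ((*) a) ?S" using a0 by (simp add: inj_on_def)
  ultimately have "(*) a ` ?S = ?T" by (intro card_subset_eq) (auto simp: card_image)
  then obtain c where c: "b = a * c" "is_sq c" using b by blast
  then obtain t where "c = t ^ 2" unfolding is_sq_def by blast
  then have "a * b = (a * t) ^ 2" using c by (simp add: power2_eq_square algebra_simps)
  then show ?thesis unfolding is_sq_def by blast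
qed

lemma psi_mult:
  fixes a b :: "'a::{field,finite}"
  assumes odd: "odd CARD('a)" and "a \<noteq> 0" "b \<noteq> 0"
  shows "psi (a * b) = psi a * psi b"
proof (cases "is_sq a \<or> is_sq b")
  case True
  then obtain t where "a = t ^ 2 \<or> b = t ^ 2" unfolding is_sq_def by blast
  then show ?thesis
    using assms psi_mult_square[of t b] psi_mult_square[of t a] by (auto simp: psi_square mult.commute)
next
  case False
  then show ?thesis using is_sq_mult_nonsquares[OF odd, of a b] by (simp add: psi_def)
qed

text \<open>
  The sets of values of \<open>a * x\<^sup>2\<close> and of \<open>1 - b * y\<^sup>2\<close> both contain more than half of the field, so they meet.
  This is what allows the entries of a diagonal form to be replaced by ones, at the cost of their product.
\<close>

lemma binary_form_represents_1:
  fixes a b :: "'a::{field,finite}"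
  assumes odd: "odd CARD('a)" and a: "a \<noteq> 0" and b: "b \<noteq> 0"
  shows "\<exists>x y. a * x ^ 2 + b * y ^ 2 = 1"
proof -
  let ?Q = "{c :: 'a. is_sq c}" and ?S = "{c :: 'a. c \<noteq> 0 \<and> is_sq c}"
  have "?Q = insert 0 ?S" by auto
  then have "card ?Q = Suc (card ?S)" by (simp add: card_insert_disjoint)
  then have Q: "2 * card ?Q = CARD('a) + 1" using card_nonzero_squares[OF odd] by simp
  let ?A = "(*) a ` ?Q" and ?B = "(\<lambda>c. 1 - b * c) ` ?Q"
  have "card ?A = card ?Q" using a by (intro card_image) (simp add: inj_on_def)
  moreover have "card ?B = card ?Q" using b by (intro card_image) (simp add: inj_on_def)
  ultimately have "CARD('a) < card ?A + card ?B" using Q by simp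
  moreover have "card (?A \<union> ?B) \<le> CARD('a)" by (intro card_mono) auto
  ultimately have "?A \<inter> ?B \<noteq> {}" by (metis card_Un_disjoint finite_code linorder_not_le)
  then obtain c d where cd: "is_sq c" "is_sq d" "a * c = 1 - b * d" by blast
  then obtain x y where "c = x ^ 2" "d = y ^ 2" unfolding is_sq_def by blast
  then show ?thesis using cd by (metis diff_add_cancel)
qed

section \<open>Congruence of matrices\<close>

lemma invertible_matI:
  fixes P :: "'a::field mat"
  assumes "P \<in> carrier_mat n n" "Q \<in> carrier_mat n n" "P * Q = 1\<^sub>m n"
  shows "invertible_mat P"
  using assms mat_mult_left_right_inverse[OF assms]
  unfolding invertible_mat_def inverts_mat_def by auto

lemma invertible_matE:
  assumes "P \<in> carrier_mat n n" "invertible_mat P"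
  obtains Q where "Q \<in> carrier_mat n n" "P * Q = 1\<^sub>m n" "Q * P = 1\<^sub>m n"
proof -
  from assms obtain Q where Q: "P * Q = 1\<^sub>m n" "Q * P = 1\<^sub>m (dim_row Q)"
    unfolding invertible_mat_def inverts_mat_def by auto
  then have "dim_col Q = n" by (metis index_mult_mat(3) index_one_mat(3))
  moreover have "dim_row Q = n" using Q(2) assms by (metis carrier_matD(2) index_mult_mat(3) index_one_mat(3))
  ultimately show ?thesis using that[of Q] Q by auto
qed

lemma mult_mat_cancel_left:
  fixes P :: "'a::semiring_1 mat"
  assumes "P * Q = 1\<^sub>m n" "P \<in> carrier_mat n n" "Q \<in> carrier_mat n n" "X \<in> carrier_mat n m"
  shows "P * (Q * X) = X"
proof -
  have "P * (Q * X) = P * Q * X" using assms(2-4) by (simp add: assoc_mult_mat[of P n n Q n X m])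
  then show ?thesis using assms(1,4) by simp
qed

lemma invertible_mat_mult:
  fixes P :: "'a::field mat"
  assumes P: "P \<in> carrier_mat n n" "invertible_mat P" and R: "R \<in> carrier_mat n n" "invertible_mat R"
  shows "invertible_mat (P * R)"
proof -
  from invertible_matE[OF P] obtain P' where P': "P' \<in> carrier_mat n n" "P * P' = 1\<^sub>m n" by blast
  from invertible_matE[OF R] obtain R' where R': "R' \<in> carrier_mat n n" "R * R' = 1\<^sub>m n" by blast
  have "R * (R' * P') = P'" using R R' P' by (intro mult_mat_cancel_left[of R R' n]) auto
  then have "(P * R) * (R' * P') = 1\<^sub>m n"
    using P R P' R' by (simp add: assoc_mult_mat[of _ n n _ n _ n])
  then show ?thesis
    using P R P' R' by (intro invertible_matI[of "P * R" n "R' * P'"]) auto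
qed

definition congruent_mat :: "nat \<Rightarrow> 'a::field mat \<Rightarrow> 'a mat \<Rightarrow> bool" where
  "congruent_mat n A B \<longleftrightarrow> A \<in> carrier_mat n n \<and> B \<in> carrier_mat n n \<and>
     (\<exists>P \<in> carrier_mat n n. invertible_mat P \<and> A = P * B * P\<^sup>T)"

lemma congruent_matI:
  assumes "P \<in> carrier_mat n n" "invertible_mat P" "B \<in> carrier_mat n n" "A = P * B * P\<^sup>T"
  shows "congruent_mat n A B"
  using assms unfolding congruent_mat_def by auto

lemma congruent_mat_refl:
  assumes "A \<in> carrier_mat n n"
  shows "congruent_mat n A A"
proof (rule congruent_matI)
  show "invertible_mat (1\<^sub>m n :: 'a mat)" by (rule invertible_matI[of _ n "1\<^sub>m n"]) auto
qed (use assms in auto)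

lemma congruent_mat_trans:
  assumes "congruent_mat n A B" "congruent_mat n B C"
  shows "congruent_mat n A C"
proof -
  from assms(1) obtain P where P: "P \<in> carrier_mat n n" "invertible_mat P" "A = P * B * P\<^sup>T"
    unfolding congruent_mat_def by blast
  from assms(2) obtain R where R: "R \<in> carrier_mat n n" "invertible_mat R" "B = R * C * R\<^sup>T"
    and C: "C \<in> carrier_mat n n"
    unfolding congruent_mat_def by blast
  show ?thesis
  proof (rule congruent_matI)
    show "invertible_mat (P * R)" using P R by (intro invertible_mat_mult) auto
    show "A = P * R * C * (P * R)\<^sup>T"
      using P R C by (simp add: transpose_mult[of _ n n _ n] assoc_mult_mat[of _ n n _ n _ n])
  qed (use P R C in auto)
qed

lemma congruent_mat_sym:
  assumes "congruent_mat n A B"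
  shows "congruent_mat n B A"
proof -
  from assms obtain P where P: "P \<in> carrier_mat n n" "invertible_mat P" "A = P * B * P\<^sup>T"
    and B: "B \<in> carrier_mat n n"
    unfolding congruent_mat_def by blast
  from invertible_matE[OF P(1,2)] obtain Q
    where Q: "Q \<in> carrier_mat n n" "P * Q = 1\<^sub>m n" "Q * P = 1\<^sub>m n" by blast
  have "P\<^sup>T * Q\<^sup>T = 1\<^sub>m n" using Q P transpose_mult[OF Q(1) P(1)] by simp
  then have eq: "B = Q * A * Q\<^sup>T"
    unfolding P(3) using P(1) Q(1) B mult_mat_cancel_left[OF Q(3,1) P(1) B]
    by (simp add: assoc_mult_mat[of _ n n _ n _ n])
  have "A \<in> carrier_mat n n" using assms unfolding congruent_mat_def by blast
  then show ?thesis
    by (rule congruent_matI[OF Q(1) invertible_matI[OF Q(1) P(1) Q(3)] _ eq])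
qed

text \<open>
  A base change in the plane spanned by the coordinates \<open>i\<close> and \<open>j\<close>, given by its two by two block.
\<close>

definition plane_mat :: "nat \<Rightarrow> nat \<Rightarrow> nat \<Rightarrow> 'a::field \<Rightarrow> 'a \<Rightarrow> 'a \<Rightarrow> 'a \<Rightarrow> 'a mat" where
  "plane_mat n i j a b c d = mat n n (\<lambda>(k, l).
     if k = i then (if l = i then a else if l = j then b else 0)
     else if k = j then (if l = i then c else if l = j then d else 0)
     else if k = l then 1 else 0)"

lemma plane_mat_carrier [simp]: "plane_mat n i j a b c d \<in> carrier_mat n n"
  "dim_row (plane_mat n i j a b c d) = n" "dim_col (plane_mat n i j a b c d) = n"
  by (simp_all add: plane_mat_def)

lemma index_plane_mat_mult:
  assumes "i < n" "j < n" "i \<noteq> j" "A \<in> carrier_mat n m" "k < n" "l < m"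
  shows "(plane_mat n i j a b c d * A) $$ (k, l) =
     (if k = i then a * A $$ (i, l) + b * A $$ (j, l)
      else if k = j then c * A $$ (i, l) + d * A $$ (j, l) else A $$ (k, l))"
proof -
  have *: "(\<Sum>t<n. (if t = i then x else if t = j then y else 0) * A $$ (t, l))
       = x * A $$ (i, l) + y * A $$ (j, l)" for x y
  proof -
    have "(\<Sum>t<n. (if t = i then x else if t = j then y else 0) * A $$ (t, l))
       = (\<Sum>t<n. (if t = i then x * A $$ (t, l) else 0) + (if t = j then y * A $$ (t, l) else 0))"
      using assms(3) by (intro sum.cong) auto
    then show ?thesis using assms by (simp add: sum.distrib)
  qed
  have "(\<Sum>t<n. (if k = t then 1 else 0) * A $$ (t, l)) = (\<Sum>t<n. if k = t then A $$ (t, l) else 0)"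
    by (intro sum.cong) auto
  then have **: "(\<Sum>t<n. (if k = t then 1 else 0) * A $$ (t, l)) = A $$ (k, l)"
    using assms by simp
  show ?thesis
    using assms * ** by (simp add: plane_mat_def scalar_prod_def lessThan_atLeast0)
qed

lemma plane_mat_invertible:
  assumes ij: "i < n" "j < n" "i \<noteq> j" and det: "a * d - b * c \<noteq> (0::'a::field)"
  shows "invertible_mat (plane_mat n i j a b c d)"
proof -
  let ?e = "a * d - b * c"
  have "plane_mat n i j a b c d * plane_mat n i j (d / ?e) (- b / ?e) (- c / ?e) (a / ?e) = 1\<^sub>m n"
  proof (rule eq_matI)
    fix k l assume kl: "k < dim_row (1\<^sub>m n :: 'a mat)" "l < dim_col (1\<^sub>m n :: 'a mat)"
    have e: "a * (d / ?e) + b * (- c / ?e) = 1" "c * (- b / ?e) + d * (a / ?e) = 1"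
      "a * (- b / ?e) + b * (a / ?e) = 0" "c * (d / ?e) + d * (- c / ?e) = 0"
      using det by (auto simp: divide_simps)
    show "(plane_mat n i j a b c d * plane_mat n i j (d / ?e) (- b / ?e) (- c / ?e) (a / ?e)) $$ (k, l)
        = 1\<^sub>m n $$ (k, l)"
      using kl ij e by (subst index_plane_mat_mult[of _ _ _ _ n]) (auto simp: plane_mat_def)
  qed (auto simp: plane_mat_def)
  then show ?thesis by (intro invertible_matI[of _ n]) auto
qed

text \<open>
  If the plane of the coordinates \<open>i\<close> and \<open>j\<close> is orthogonal to all other coordinates, a base change of that plane
  only changes the two by two block of the form.
\<close>

lemma congruent_plane_mat:
  assumes ij: "i < n" "j < n" "i \<noteq> j" and det: "a * d - b * c \<noteq> (0::'a::field)"
    and A: "A \<in> carrier_mat n n" and B: "B \<in> carrier_mat n n"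
    and sym: "A\<^sup>T = A"
    and off: "\<And>k. k < n \<Longrightarrow> k \<noteq> i \<Longrightarrow> k \<noteq> j \<Longrightarrow> A $$ (k, i) = 0 \<and> A $$ (k, j) = 0"
    and B_eq: "\<And>k l. k < n \<Longrightarrow> l < n \<Longrightarrow> k \<noteq> i \<Longrightarrow> k \<noteq> j \<Longrightarrow> B $$ (k, l) = A $$ (k, l)"
      "B\<^sup>T = B"
      "B $$ (i, i) = a\<^sup>2 * A $$ (i, i) + 2 * a * b * A $$ (i, j) + b\<^sup>2 * A $$ (j, j)"
      "B $$ (j, j) = c\<^sup>2 * A $$ (i, i) + 2 * c * d * A $$ (i, j) + d\<^sup>2 * A $$ (j, j)"
      "B $$ (i, j) = a * c * A $$ (i, i) + (a * d + b * c) * A $$ (i, j) + b * d * A $$ (j, j)"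
  shows "congruent_mat n B A"
proof (rule congruent_matI)
  let ?P = "plane_mat n i j a b c d"
  have symA: "A $$ (k, l) = A $$ (l, k)" if "k < n" "l < n" for k l
    using sym A that by (metis index_transpose_mat(1) carrier_matD)
  have symB: "B $$ (k, l) = B $$ (l, k)" if "k < n" "l < n" for k l
    using B_eq(2) B that by (metis index_transpose_mat(1) carrier_matD)
  have off_rows: "A $$ (i, k) = 0" "A $$ (j, k) = 0" if "k < n" "k \<noteq> i" "k \<noteq> j" for k
    using off[OF that] symA[of i k] symA[of j k] that ij by auto
  have off_B: "B $$ (k, i) = 0" "B $$ (k, j) = 0" "B $$ (i, k) = 0" "B $$ (j, k) = 0"
    if "k < n" "k \<noteq> i" "k \<noteq> j" for k
    using off[OF that] symB[of i k] symB[of j k] B_eq(1)[of k i] B_eq(1)[of k j] that ij by auto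
  have A_ji: "A $$ (j, i) = A $$ (i, j)" and B_ji: "B $$ (j, i) = B $$ (i, j)"
    using symA[of j i] symB[of j i] ij by auto
  have PA: "?P * A \<in> carrier_mat n n" using A by (rule mult_carrier_mat[OF plane_mat_carrier(1)])
  have t: "?P * A * ?P\<^sup>T = (?P * (?P * A)\<^sup>T)\<^sup>T"
    using PA by (subst transpose_mult[of _ n n _ n]) auto
  show "B = ?P * A * ?P\<^sup>T" unfolding t
  proof (rule eq_matI)
    fix k l assume "k < dim_row ((?P * (?P * A)\<^sup>T)\<^sup>T)" "l < dim_col ((?P * (?P * A)\<^sup>T)\<^sup>T)"
    then have kl: "k < n" "l < n" using PA by auto
    have "(?P * (?P * A)\<^sup>T)\<^sup>T $$ (k, l) = (?P * (?P * A)\<^sup>T) $$ (l, k)"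
      using PA kl by auto
    also have "\<dots> = (if l = i then a * (?P * A) $$ (k, i) + b * (?P * A) $$ (k, j)
      else if l = j then c * (?P * A) $$ (k, i) + d * (?P * A) $$ (k, j) else (?P * A) $$ (k, l))"
      using A PA kl ij by (subst index_plane_mat_mult[OF ij, of _ n]) auto
    also have "\<dots> = B $$ (k, l)"
      using kl ij A off B_eq(1) off_rows off_B A_ji B_ji B_eq(3-5)
      by (simp add: index_plane_mat_mult[OF ij, of _ n] del: index_mult_mat)
        (auto simp: algebra_simps power2_eq_square)
    finally show "B $$ (k, l) = (?P * (?P * A)\<^sup>T)\<^sup>T $$ (k, l)" by simp
  qed (use A B in auto)
qed (use assms plane_mat_invertible in auto)

lemma dim_mat_diag [simp]: "dim_row (mat_diag n f) = n" "dim_col (mat_diag n f) = n"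
  by (simp_all add: mat_diag_def)

lemma mat_diag_transpose [simp]: "(mat_diag n f)\<^sup>T = mat_diag n f"
  by (rule eq_matI) (auto simp: mat_diag_def)

lemma index_mat_diag [simp]:
  "i < n \<Longrightarrow> j < n \<Longrightarrow> mat_diag n f $$ (i, j) = (if i = j then f j else 0)"
  by (simp add: mat_diag_def)

lemma congruent_diag_plane:
  assumes ij: "i < n" "j < n" "i \<noteq> j" and det: "a * d - b * c \<noteq> (0::'a::field)"
    and "x = a\<^sup>2 * f i + b\<^sup>2 * f j" "y = c\<^sup>2 * f i + d\<^sup>2 * f j" "a * c * f i + b * d * f j = 0"
  shows "congruent_mat n (mat_diag n (f(i := x, j := y))) (mat_diag n f)"
proof (rule congruent_plane_mat[OF ij det])
  show "mat_diag n (f(i := x, j := y)) $$ (i, j)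
      = a * c * mat_diag n f $$ (i, i) + (a * d + b * c) * mat_diag n f $$ (i, j)
        + b * d * mat_diag n f $$ (j, j)"
    using ij assms(7) by simp
qed (use ij assms(5,6) in simp_all)

lemma congruent_diag_swap:
  fixes f :: "nat \<Rightarrow> 'a::field"
  assumes ij: "i < n" "j < n"
  shows "congruent_mat n (mat_diag n (f(i := f j, j := f i))) (mat_diag n f)"
proof (cases "i = j")
  case True
  then show ?thesis by (simp add: congruent_mat_refl)
next
  case False
  then show ?thesis using congruent_diag_plane[OF ij False, of 0 0 1 1 "f j" f "f i"] by simp
qed

lemma congruent_diag_scale:
  fixes f :: "nat \<Rightarrow> 'a::field"
  assumes i: "i < n" and t: "t \<noteq> 0"
  shows "congruent_mat n (mat_diag n (f(i := f i * t\<^sup>2))) (mat_diag n f)"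
proof (rule congruent_matI)
  let ?P = "mat_diag n (\<lambda>k. if k = i then t else 1)"
  let ?Q = "mat_diag n (\<lambda>k. if k = i then 1 / t else 1)"
  have "?P * ?Q = mat_diag n (\<lambda>k. 1)" unfolding mat_diag_diag using t by (intro arg_cong[of _ _ "mat_diag n"]) auto
  then show "invertible_mat ?P" by (intro invertible_matI[of _ n ?Q]) auto
  show "mat_diag n (f(i := f i * t\<^sup>2)) = ?P * mat_diag n f * ?P\<^sup>T"
    by (auto intro!: arg_cong[of _ _ "mat_diag n"] simp: power2_eq_square)
qed auto

section \<open>Bordered matrices\<close>

text \<open>
  The diagonal of the normal form as a function, so that entries can be updated and the size varied.
\<close>

definition normal_entries :: "nat \<Rightarrow> 'a::field \<Rightarrow> nat \<Rightarrow> 'a" where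
  "normal_entries k d i = (if i + 1 < k then 1 else if i + 1 = k then d else 0)"

lemma diag_normal_form_eq: "diag_normal_form n k d = mat_diag n (normal_entries k d)"
  by (simp add: diag_normal_form_def normal_entries_def[abs_def])

lemma mat_diag_cong:
  assumes "\<And>i. i < n \<Longrightarrow> f i = g i"
  shows "mat_diag n f = mat_diag n g"
  using assms by (intro eq_matI) (auto simp: mat_diag_def)

abbreviation diag_rank :: "nat \<Rightarrow> (nat \<Rightarrow> 'a::field) \<Rightarrow> nat" where
  "diag_rank n f \<equiv> card {i. i < n \<and> f i \<noteq> 0}"

abbreviation diag_disc :: "nat \<Rightarrow> (nat \<Rightarrow> 'a::field) \<Rightarrow> 'a" where
  "diag_disc n f \<equiv> (\<Prod>i | i < n \<and> f i \<noteq> 0. f i)"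

definition border :: "nat \<Rightarrow> 'a::field mat \<Rightarrow> 'a vec \<Rightarrow> 'a \<Rightarrow> 'a mat" where
  "border n B v c = four_block_mat B (mat_of_cols n [v]) (mat_of_rows n [v]) (mat 1 1 (\<lambda>_. c))"

lemma border_carrier [simp]:
  "B \<in> carrier_mat n n \<Longrightarrow> border n B v c \<in> carrier_mat (Suc n) (Suc n)"
  by (auto simp: border_def)

lemma index_border:
  assumes "B \<in> carrier_mat n n" "v \<in> carrier_vec n" "i < Suc n" "j < Suc n"
  shows "border n B v c $$ (i, j) =
    (if i < n then if j < n then B $$ (i, j) else v $ i else if j < n then v $ j else c)"
  using assms by (auto simp: border_def mat_of_cols_def mat_of_rows_def)

lemma mult_mat_of_cols_single:
  fixes M :: "'a::field mat"
  assumes "M \<in> carrier_mat n n" "v \<in> carrier_vec n"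
  shows "M * mat_of_cols n [v] = mat_of_cols n [M *\<^sub>v v]"
  using assms by (intro eq_matI) (auto simp: mat_of_cols_def col_def scalar_prod_def)

lemma transpose_mat_of_cols_single:
  "(mat_of_cols n [v])\<^sup>T = mat_of_rows n [v]" "(mat_of_rows n [v])\<^sup>T = mat_of_cols n [v]"
  by (simp_all add: transpose_mat_of_cols transpose_mat_of_rows)

text \<open>
  Base change in the upper left corner, with the new basis vector kept.
\<close>

lemma border_congruent:
  fixes M :: "'a::field mat"
  assumes M: "M \<in> carrier_mat n n" "invertible_mat M"
    and B: "B \<in> carrier_mat n n" and v: "v \<in> carrier_vec n"
  shows "congruent_mat (Suc n) (border n (M * B * M\<^sup>T) (M *\<^sub>v v) c) (border n B v c)"
proof -
  let ?V = "mat_of_cols n [v]" and ?V' = "mat_of_rows n [v]" and ?C = "mat 1 1 (\<lambda>_. c)"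
  let ?L = "four_block_mat M (0\<^sub>m n 1) (0\<^sub>m 1 n) (1\<^sub>m 1)"
  have [simp]: "?V \<in> carrier_mat n 1" "?V' \<in> carrier_mat 1 n" "?C \<in> carrier_mat 1 1" by auto
  from invertible_matE[OF M] obtain Q where Q: "Q \<in> carrier_mat n n" "M * Q = 1\<^sub>m n" by blast
  have "?L * four_block_mat Q (0\<^sub>m n 1) (0\<^sub>m 1 n) (1\<^sub>m 1)
      = four_block_mat (1\<^sub>m n) (0\<^sub>m n 1) (0\<^sub>m 1 n) (1\<^sub>m 1)"
    using M Q by (subst mult_four_block_mat[of _ n n _ 1 _ 1]) auto
  then have "?L * four_block_mat Q (0\<^sub>m n 1) (0\<^sub>m 1 n) (1\<^sub>m 1) = 1\<^sub>m (Suc n)" by simp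
  then have inv: "invertible_mat ?L"
    using M Q by (intro invertible_matI[of _ "Suc n"]) (auto intro!: four_block_carrier_mat[of _ n n _ 1 1, simplified])
  have MV: "M * ?V = mat_of_cols n [M *\<^sub>v v]" using mult_mat_of_cols_single M v by blast
  have VM: "?V' * M\<^sup>T = mat_of_rows n [M *\<^sub>v v]"
    by (metis MV M(1) \<open>?V \<in> carrier_mat n 1\<close> transpose_mat_of_cols_single(1) transpose_mult)
  have LT: "?L\<^sup>T = four_block_mat M\<^sup>T (0\<^sub>m n 1) (0\<^sub>m 1 n) (1\<^sub>m 1)"
    using M by (subst transpose_four_block_mat[of _ n n _ 1 _ 1]) auto
  have "?L * border n B v c = four_block_mat (M * B) (M * ?V) ?V' ?C"
    unfolding border_def using M B by (subst mult_four_block_mat[of _ n n _ 1 _ 1]) auto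
  also have "\<dots> * ?L\<^sup>T = four_block_mat (M * B * M\<^sup>T) (M * ?V) (?V' * M\<^sup>T) ?C"
    unfolding LT using M B by (subst mult_four_block_mat[of _ n n _ 1 _ 1]) auto
  finally have "border n (M * B * M\<^sup>T) (M *\<^sub>v v) c = ?L * border n B v c * ?L\<^sup>T"
    unfolding border_def MV VM by simp
  then show ?thesis
    using M B inv
    by (intro congruent_matI[of ?L]) (auto intro!: four_block_carrier_mat[of _ n n _ 1 1, simplified])
qed

text \<open>
  If the border lies in the column space of \<open>B\<close>, subtracting \<open>w\<close> from the new basis vector makes it orthogonal
  to the old ones; its length becomes the Schur complement.
\<close>

lemma border_schur_congruent:
  fixes B :: "'a::field mat"
  assumes B: "B \<in> carrier_mat n n" "B\<^sup>T = B" and w: "w \<in> carrier_vec n"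
  shows "congruent_mat (Suc n) (border n B (B *\<^sub>v w) c) (border n B (0\<^sub>v n) (c - w \<bullet> (B *\<^sub>v w)))"
proof -
  let ?W = "mat_of_cols n [w]" and ?W' = "mat_of_rows n [w]" and ?C = "mat 1 1 (\<lambda>_. c - w \<bullet> (B *\<^sub>v w))"
  let ?L = "four_block_mat (1\<^sub>m n) (0\<^sub>m n 1) ?W' (1\<^sub>m 1)"
  have [simp]: "?W \<in> carrier_mat n 1" "?W' \<in> carrier_mat 1 n" "?C \<in> carrier_mat 1 1" by auto
  have "?L * four_block_mat (1\<^sub>m n) (0\<^sub>m n 1) (- ?W') (1\<^sub>m 1)
      = four_block_mat (1\<^sub>m n) (0\<^sub>m n 1) (0\<^sub>m 1 n) (1\<^sub>m 1)"
    by (subst mult_four_block_mat[of _ n n _ 1 _ 1]) auto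
  then have "?L * four_block_mat (1\<^sub>m n) (0\<^sub>m n 1) (- ?W') (1\<^sub>m 1) = 1\<^sub>m (Suc n)" by simp
  then have inv: "invertible_mat ?L"
    by (intro invertible_matI[of _ "Suc n"]) (auto intro!: four_block_carrier_mat[of _ n n _ 1 1, simplified])
  have BW: "B * ?W = mat_of_cols n [B *\<^sub>v w]" using mult_mat_of_cols_single B w by blast
  have WB: "?W' * B = mat_of_rows n [B *\<^sub>v w]"
    by (metis BW B \<open>?W \<in> carrier_mat n 1\<close> transpose_mat_of_cols_single(1) transpose_mult)
  have WBW: "mat_of_rows n [B *\<^sub>v w] * ?W + ?C = mat 1 1 (\<lambda>_. c)"
    using B w by (intro eq_matI) (auto simp: mat_of_rows_def mat_of_cols_def scalar_prod_def mult.commute)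
  have LT: "?L\<^sup>T = four_block_mat (1\<^sub>m n) ?W (0\<^sub>m 1 n) (1\<^sub>m 1)"
    by (subst transpose_four_block_mat[of _ n n _ 1 _ 1]) (auto simp: transpose_mat_of_cols_single)
  have Z: "mat_of_cols n [0\<^sub>v n] = (0\<^sub>m n 1 :: 'a mat)" "mat_of_rows n [0\<^sub>v n] = (0\<^sub>m 1 n :: 'a mat)"
    by (auto simp: mat_of_cols_def mat_of_rows_def)
  have "?L * border n B (0\<^sub>v n) (c - w \<bullet> (B *\<^sub>v w)) = four_block_mat B (0\<^sub>m n 1) (?W' * B) ?C"
    unfolding border_def Z using B by (subst mult_four_block_mat[of _ n n _ 1 _ 1]) auto
  also have "\<dots> * ?L\<^sup>T = four_block_mat B (B * ?W) (?W' * B) (?W' * B * ?W + ?C)"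
    unfolding LT using B by (subst mult_four_block_mat[of _ n n _ 1 _ 1]) auto
  finally have "border n B (B *\<^sub>v w) c = ?L * border n B (0\<^sub>v n) (c - w \<bullet> (B *\<^sub>v w)) * ?L\<^sup>T"
    unfolding WB BW WBW by (simp add: border_def)
  then show ?thesis
    using B inv
    by (intro congruent_matI[of ?L]) (auto intro!: four_block_carrier_mat[of _ n n _ 1 1, simplified])
qed

lemma border_zero_diag:
  "border n (mat_diag n f) (0\<^sub>v n) c = mat_diag (Suc n) (f(n := c))"
proof (rule eq_matI)
  fix i j assume "i < dim_row (mat_diag (Suc n) (f(n := c)))" "j < dim_col (mat_diag (Suc n) (f(n := c)))"
  then show "border n (mat_diag n f) (0\<^sub>v n) c $$ (i, j) = mat_diag (Suc n) (f(n := c)) $$ (i, j)"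
    by (auto simp: index_border)
qed (auto simp: border_def)

section \<open>Diagonal matrices in normal form\<close>

text \<open>
  The product of the nonzero entries is carried along exactly, not only up to squares. In the induction step the last
  nonzero entry of the old normal form and the new entry \<open>c\<close> span a plane that represents 1, so they can be
  replaced by 1 and their product, which is then moved next to the other nonzero entries.
\<close>

lemma mat_diag_congruent_normal:
  fixes f :: "nat \<Rightarrow> 'a::{field,finite}"
  assumes odd: "odd CARD('a)"
  shows "congruent_mat n (mat_diag n f) (mat_diag n (normal_entries (diag_rank n f) (diag_disc n f)))"
proof (induction n)
  case 0
  have "mat_diag 0 f = mat_diag 0 (normal_entries (diag_rank 0 f) (diag_disc 0 f))"
    by (rule mat_diag_cong) simp
  then show ?case by (metis congruent_mat_refl mat_diag_dim)
next
  case (Suc n)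
  define k d c where "k = diag_rank n f" and "d = diag_disc n f" and "c = f n"
  let ?g = "(normal_entries k d)(n := c)"
  have fin: "finite {i. i < n \<and> f i \<noteq> 0}" by simp
  have "k \<le> card {i. i < n}" unfolding k_def by (rule card_mono) auto
  then have kn: "k \<le> n" by simp
  have d0: "d \<noteq> 0" unfolding d_def by (simp add: prod_zero_iff[OF fin])
  have k0: "d = 1" if "k = 0"
  proof -
    have "{i. i < n \<and> f i \<noteq> 0} = {}" using that card_0_eq[OF fin] unfolding k_def by blast
    then show ?thesis unfolding d_def by (simp only: prod.empty)
  qed
  have "congruent_mat (Suc n) (mat_diag (Suc n) f) (mat_diag (Suc n) ?g)"
  proof -
    from Suc obtain P where P: "P \<in> carrier_mat n n" "invertible_mat P"
      "mat_diag n f = P * mat_diag n (normal_entries k d) * P\<^sup>T"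
      unfolding congruent_mat_def k_def d_def by blast
    have "P *\<^sub>v 0\<^sub>v n = 0\<^sub>v n" using P(1) by (intro eq_vecI) auto
    then have "congruent_mat (Suc n) (border n (mat_diag n f) (0\<^sub>v n) c)
        (border n (mat_diag n (normal_entries k d)) (0\<^sub>v n) c)"
      using border_congruent[OF P(1,2), of "mat_diag n (normal_entries k d)" "0\<^sub>v n" c] P(3) by simp
    then show ?thesis unfolding border_zero_diag c_def by simp
  qed
  note g = this
  show ?case
  proof (cases "c = 0")
    case True
    then have eq: "{i. i < Suc n \<and> f i \<noteq> 0} = {i. i < n \<and> f i \<noteq> 0}"
      unfolding c_def using less_Suc_eq by auto
    have "mat_diag (Suc n) ?g = mat_diag (Suc n) (normal_entries k d)"
      using kn True by (intro mat_diag_cong) (auto simp: normal_entries_def)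
    then show ?thesis using g unfolding eq k_def d_def by simp
  next
    case False
    then have eq: "{i. i < Suc n \<and> f i \<noteq> 0} = insert n {i. i < n \<and> f i \<noteq> 0}"
      unfolding c_def using less_Suc_eq by auto
    have rank: "diag_rank (Suc n) f = Suc k" unfolding eq k_def by simp
    have disc: "diag_disc (Suc n) f = d * c" unfolding eq d_def c_def by simp
    \<comment> \<open>In rank 0 there is no entry to combine with \<open>c\<close>, and \<open>d = 1\<close> makes \<open>d * c = c\<close>.\<close>
    define h where "h = (if k = 0 then ?g else ?g(k - 1 := 1, n := d * c))"
    have gh: "congruent_mat (Suc n) (mat_diag (Suc n) ?g) (mat_diag (Suc n) h)"
    proof (cases "k = 0")
      case True
      then show ?thesis unfolding h_def by (simp add: congruent_mat_refl)
    next
      case k: False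
      obtain x y where xy: "d * x\<^sup>2 + c * y\<^sup>2 = 1"
        using binary_form_represents_1[OF odd d0 False] by blast
      have gk: "?g (k - 1) = d" "?g n = c" using k kn by (auto simp: normal_entries_def)
      \<comment> \<open>The block with rows \<open>(x, y)\<close> and \<open>(- c * y, d * x)\<close> takes \<open>diag(d, c)\<close> to \<open>diag(1, d * c)\<close>.\<close>
      have det: "x * (d * x) - y * (- c * y) = 1"
        using xy by (simp add: power2_eq_square algebra_simps)
      have "d * c = d * c * (d * x\<^sup>2 + c * y\<^sup>2)" using xy by simp
      also have "\<dots> = (- c * y)\<^sup>2 * d + (d * x)\<^sup>2 * c"
        by (simp add: power2_eq_square algebra_simps)
      finally have e: "d * c = (- c * y)\<^sup>2 * ?g (k - 1) + (d * x)\<^sup>2 * ?g n" unfolding gk .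
      have "congruent_mat (Suc n) (mat_diag (Suc n) (?g(k - 1 := 1, n := d * c))) (mat_diag (Suc n) ?g)"
      proof (rule congruent_diag_plane[where a = x and b = y and c = "- c * y" and d = "d * x", OF _ _ _ _ _ e])
        show "x * (d * x) - y * (- c * y) \<noteq> 0" unfolding det by simp
        show "1 = x\<^sup>2 * ?g (k - 1) + y\<^sup>2 * ?g n" unfolding gk using xy by (simp add: mult.commute)
        show "x * (- c * y) * ?g (k - 1) + y * (d * x) * ?g n = 0" unfolding gk by simp
      qed (use k kn in auto)
      from congruent_mat_sym[OF this] show ?thesis unfolding h_def using k by simp
    qed
    have hs: "congruent_mat (Suc n) (mat_diag (Suc n) h) (mat_diag (Suc n) (h(k := h n, n := h k)))"
      by (rule congruent_mat_sym, rule congruent_diag_swap) (use kn in auto)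
    have "mat_diag (Suc n) (h(k := h n, n := h k)) = mat_diag (Suc n) (normal_entries (Suc k) (d * c))"
    proof (rule mat_diag_cong)
      fix i assume "i < Suc n"
      have "(h(k := h n, n := h k)) i
          = (if i = k then h n else if i = n then h k else h i)" by simp
      moreover have "h n = d * c" using k0 by (simp add: h_def)
      moreover have "h k = 0" if "k \<noteq> n" using that by (auto simp: h_def normal_entries_def)
      moreover have "h i = (if i < k then 1 else 0)" if "i \<noteq> n"
        using that by (auto simp: h_def normal_entries_def)
      ultimately show "(h(k := h n, n := h k)) i = normal_entries (Suc k) (d * c) i"
        using kn by (cases "k = n") (simp_all add: normal_entries_def)
    qed
    then show ?thesis unfolding rank disc
      using congruent_mat_trans[OF g congruent_mat_trans[OF gh hs]] by simp
  qed
qed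

section \<open>Invariants of congruence\<close>

lemma bij_betw_append_zeros:
  assumes "k \<le> n"
  shows "bij_betw (\<lambda>x. x @\<^sub>v 0\<^sub>v (n - k)) (carrier_vec k)
           {x :: 'a::field vec. x \<in> carrier_vec n \<and> (\<forall>i. k \<le> i \<and> i < n \<longrightarrow> x $ i = 0)}"
proof (rule bij_betw_byWitness[where f' = "\<lambda>x. vec k (\<lambda>i. x $ i)"])
  show "\<forall>x \<in> carrier_vec k. vec k (\<lambda>i. (x @\<^sub>v 0\<^sub>v (n - k)) $ i) = (x :: 'a vec)"
    by (intro ballI eq_vecI) auto
  show "\<forall>x \<in> {x :: 'a vec. x \<in> carrier_vec n \<and> (\<forall>i. k \<le> i \<and> i < n \<longrightarrow> x $ i = 0)}.
      vec k (\<lambda>i. x $ i) @\<^sub>v 0\<^sub>v (n - k) = x"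
    using assms by (intro ballI eq_vecI) auto
  show "(\<lambda>x. x @\<^sub>v 0\<^sub>v (n - k)) ` carrier_vec k
      \<subseteq> {x :: 'a vec. x \<in> carrier_vec n \<and> (\<forall>i. k \<le> i \<and> i < n \<longrightarrow> x $ i = 0)}"
    using append_carrier_vec[OF _ zero_carrier_vec, of _ k "n - k"] assms by auto
qed auto

lemma card_gt_1_field: "1 < CARD('a::{field,finite})"
proof -
  have "card {0, 1 :: 'a} \<le> CARD('a)" by (rule card_mono) auto
  then show ?thesis by simp
qed

lemma mat_diag_mult_vec:
  assumes "x \<in> carrier_vec n" "i < n"
  shows "(mat_diag n f *\<^sub>v x) $ i = f i * (x $ i :: 'a::field)"
proof -
  have "(mat_diag n f *\<^sub>v x) $ i = (\<Sum>j = 0..<n. (if i = j then f j else 0) * x $ j)"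
    using assms by (simp add: scalar_prod_def)
  also have "\<dots> = (\<Sum>j = 0..<n. if i = j then f j * x $ j else 0)"
    by (intro sum.cong) auto
  finally show ?thesis using assms by simp
qed

text \<open>
  Congruent matrices have column spaces of the same size, as an invertible matrix acts bijectively on vectors.
\<close>

lemma rank_congruent:
  fixes A B :: "'a::{field,finite} mat"
  assumes "congruent_mat n A B"
  shows "vec_space.rank n A = vec_space.rank n B"
proof -
  from assms obtain P where P: "P \<in> carrier_mat n n" "invertible_mat P" "A = P * B * P\<^sup>T"
    and A: "A \<in> carrier_mat n n" and B: "B \<in> carrier_mat n n"
    unfolding congruent_mat_def by blast
  from invertible_matE[OF P(1,2)] obtain Q
    where Q: "Q \<in> carrier_mat n n" "P * Q = 1\<^sub>m n" "Q * P = 1\<^sub>m n" by blast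
  let ?im = "\<lambda>M :: 'a mat. (\<lambda>x. M *\<^sub>v x) ` carrier_vec n"
  have QP: "Q *\<^sub>v (P *\<^sub>v x) = x" if "x \<in> carrier_vec n" for x
    using that P(1) Q by (simp add: assoc_mult_mat_vec[symmetric, of Q n n P n])
  have PQT: "P\<^sup>T *\<^sub>v (Q\<^sup>T *\<^sub>v x) = x" if "x \<in> carrier_vec n" for x
  proof -
    have "P\<^sup>T * Q\<^sup>T = 1\<^sub>m n" using Q P transpose_mult[OF Q(1) P(1)] by simp
    then show ?thesis using that P(1) Q(1) by (simp add: assoc_mult_mat_vec[symmetric, of _ n n _ n])
  qed
  have "?im (P\<^sup>T) = carrier_vec n"
  proof
    show "carrier_vec n \<subseteq> ?im (P\<^sup>T)"
    proof
      fix x :: "'a vec" assume "x \<in> carrier_vec n"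
      then show "x \<in> ?im (P\<^sup>T)"
        using PQT Q(1) by (intro image_eqI[of x _ "Q\<^sup>T *\<^sub>v x"]) auto
    qed
  qed (use P(1) in auto)
  moreover have "?im A = (\<lambda>x. P *\<^sub>v x) ` (\<lambda>x. B *\<^sub>v x) ` ?im (P\<^sup>T)"
    unfolding P(3) image_image
    using P(1) B by (intro image_cong) (auto simp: assoc_mult_mat_vec[of _ n n _ n])
  ultimately have "?im A = (\<lambda>x. P *\<^sub>v x) ` ?im B" by simp
  moreover have "inj_on (\<lambda>x. P *\<^sub>v x) (?im B)"
    using QP B by (intro inj_on_inverseI[where g = "\<lambda>x. Q *\<^sub>v x"]) auto
  ultimately have "card (?im A) = card (?im B)" by (simp add: card_image)
  then have "CARD('a) ^ vec_space.rank n A = CARD('a) ^ vec_space.rank n B"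
    using card_image_mat_rank[OF A] card_image_mat_rank[OF B] by simp
  then show ?thesis using card_gt_1_field[where 'a = 'a] by (simp add: power_inject_exp)
qed

lemma rank_mat_diag_normal:
  fixes d :: "'a::{field,finite}"
  assumes k: "k \<le> n" and d: "d \<noteq> 0"
  shows "vec_space.rank n (mat_diag n (normal_entries k d)) = k"
proof -
  let ?D = "mat_diag n (normal_entries k d)"
  let ?Z = "{x :: 'a vec. x \<in> carrier_vec n \<and> (\<forall>i. k \<le> i \<and> i < n \<longrightarrow> x $ i = 0)}"
  have idx: "(?D *\<^sub>v x) $ i = normal_entries k d i * x $ i" if "x \<in> carrier_vec n" "i < n" for x i
    using mat_diag_mult_vec[OF that] .
  have "(\<lambda>x. ?D *\<^sub>v x) ` carrier_vec n = ?Z"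
  proof
    show "(\<lambda>x. ?D *\<^sub>v x) ` carrier_vec n \<subseteq> ?Z"
    proof
      fix y assume "y \<in> (\<lambda>x. ?D *\<^sub>v x) ` carrier_vec n"
      then obtain x where x: "x \<in> carrier_vec n" "y = ?D *\<^sub>v x" by blast
      then have "y \<in> carrier_vec n" by (auto intro!: carrier_vecI)
      moreover have "y $ i = 0" if "k \<le> i" "i < n" for i
        using that x(2) idx[OF x(1) that(2)] by (simp add: normal_entries_def)
      ultimately show "y \<in> ?Z" by blast
    qed
    show "?Z \<subseteq> (\<lambda>x. ?D *\<^sub>v x) ` carrier_vec n"
    proof
      fix x assume x: "x \<in> ?Z"
      let ?y = "vec n (\<lambda>i. x $ i / (if i + 1 = k then d else 1))"
      have "?D *\<^sub>v ?y = x"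
      proof (rule eq_vecI)
        fix i assume "i < dim_vec x"
        then have i: "i < n" using x by auto
        then show "(?D *\<^sub>v ?y) $ i = x $ i" using x d idx[of ?y i] by (auto simp: normal_entries_def)
      qed (use x in auto)
      then show "x \<in> (\<lambda>x. ?D *\<^sub>v x) ` carrier_vec n" by (intro image_eqI[of _ _ ?y]) auto
    qed
  qed
  moreover have "card ?Z = CARD('a) ^ k"
    using bij_betw_same_card[OF bij_betw_append_zeros[OF k, where 'a = 'a]] by (simp add: card_carrier_vec)
  ultimately have "CARD('a) ^ vec_space.rank n ?D = CARD('a) ^ k"
    using card_image_mat_rank[of ?D n n] by simp
  then show ?thesis using card_gt_1_field[where 'a = 'a] by (simp add: power_inject_exp)
qed

lemma prod_normal_entries:
  assumes "k = 0 \<longrightarrow> d = (1::'a::field)"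
  shows "(\<Prod>i<k. normal_entries k d i) = d"
proof (cases k)
  case (Suc m)
  have "(\<Prod>i<m. normal_entries k d i) = 1"
    using Suc by (intro prod.neutral) (auto simp: normal_entries_def)
  then show ?thesis using Suc by (simp add: normal_entries_def)
qed (use assms in simp)

lemma det_mat_diag_normal:
  assumes "k \<ge> 1"
  shows "det (mat_diag k (normal_entries k d)) = (d :: 'a::field)"
proof -
  have "upper_triangular (mat_diag k (normal_entries k d))"
    by (auto simp: upper_triangular_def)
  then have "det (mat_diag k (normal_entries k d)) = prod_list (diag_mat (mat_diag k (normal_entries k d)))"
    by (rule det_upper_triangular[OF _ mat_diag_dim])
  also have "\<dots> = (\<Prod>i = 0..<k. normal_entries k d i)"
    unfolding prod_list_diag_prod by (intro prod.cong) auto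
  also have "\<dots> = d"
    using prod_normal_entries[of k d] assms by (simp add: lessThan_atLeast0)
  finally show ?thesis .
qed

text \<open>
  Only the first \<open>k\<close> columns of the base change meet the nonzero entries of the form. The upper left
  \<open>k\<times>k\<close> blocks are therefore congruent themselves, and comparing determinants shows that \<open>d\<close> and \<open>e\<close>
  differ by a square.
\<close>

lemma psi_congruent_normal:
  fixes d e :: "'a::field"
  assumes k: "1 \<le> k" "k \<le> n" and d: "d \<noteq> 0"
    and cong: "congruent_mat n (mat_diag n (normal_entries k d)) (mat_diag n (normal_entries k e))"
  shows "psi d = psi e"
proof -
  let ?D = "mat_diag n (normal_entries k e)"
  from cong obtain P where P: "P \<in> carrier_mat n n" "mat_diag n (normal_entries k d) = P * ?D * P\<^sup>T"
    unfolding congruent_mat_def by blast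
  define R where "R = mat k k (\<lambda>(i, j). P $$ (i, j))"
  have R: "R \<in> carrier_mat k k" by (simp add: R_def)
  let ?N = "\<lambda>d. mat_diag k (normal_entries k d)"
  have "?N d = R * ?N e * R\<^sup>T"
  proof (rule eq_matI)
    fix i j assume "i < dim_row (R * ?N e * R\<^sup>T)" "j < dim_col (R * ?N e * R\<^sup>T)"
    then have ij: "i < k" "j < k" using R by auto
    then have ij': "i < n" "j < n" using k by auto
    have "?N d $$ (i, j) = mat_diag n (normal_entries k d) $$ (i, j)" using ij ij' by simp
    also have "\<dots> = (P * ?D * P\<^sup>T) $$ (i, j)" using P(2) by simp
    also have "\<dots> = (\<Sum>l = 0..<n. P $$ (i, l) * normal_entries k e l * P $$ (j, l))"
      unfolding mat_diag_mult_right[OF P(1)] using P(1) ij' by (simp add: scalar_prod_def)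
    also have "\<dots> = (\<Sum>l = 0..<k. P $$ (i, l) * normal_entries k e l * P $$ (j, l))"
      using k by (intro sum.mono_neutral_right) (auto simp: normal_entries_def)
    also have "\<dots> = (R * ?N e * R\<^sup>T) $$ (i, j)"
      unfolding mat_diag_mult_right[OF R] using R ij by (simp add: scalar_prod_def R_def)
    finally show "?N d $$ (i, j) = (R * ?N e * R\<^sup>T) $$ (i, j)" .
  qed (use R in auto)
  then have "det (?N d) = det R * det (?N e) * det R"
    using R by (simp add: det_mult[of _ k] det_transpose)
  then have "d = e * (det R)\<^sup>2"
    using det_mat_diag_normal[OF k(1), of d] det_mat_diag_normal[OF k(1), of e]
    by (simp add: power2_eq_square ac_simps)
  then show ?thesis using psi_mult_square[of "det R" e] d by auto
qed

section \<open>Rank and character\<close>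

text \<open>
  Rank and character together, read off from any diagonal form with a nonzero last entry. Allowing every nonzero
  \<open>d\<close> instead of 1 and the nonsquares avoids a renormalisation after each computation; the convention for
  the zero matrix becomes the condition on \<open>k = 0\<close>.
\<close>

definition rank_char :: "nat \<Rightarrow> 'a::field mat \<Rightarrow> nat \<Rightarrow> int \<Rightarrow> bool" where
  "rank_char n A k s \<longleftrightarrow> k \<le> n \<and>
     (\<exists>d. d \<noteq> 0 \<and> (k = 0 \<longrightarrow> d = 1) \<and> psi d = s \<and>
          congruent_mat n A (mat_diag n (normal_entries k d)))"

lemma rank_char_congruent:
  assumes "congruent_mat n A B" "rank_char n B k s"
  shows "rank_char n A k s"
  using assms congruent_mat_trans[OF assms(1)] unfolding rank_char_def by blast

lemma rank_char_diag:
  fixes f :: "nat \<Rightarrow> 'a::{field,finite}"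
  assumes odd: "odd CARD('a)"
  shows "rank_char n (mat_diag n f) (diag_rank n f) (psi (diag_disc n f))"
proof -
  have fin: "finite {i. i < n \<and> f i \<noteq> 0}" by simp
  have "diag_rank n f \<le> card {i. i < n}" by (rule card_mono) auto
  then have "diag_rank n f \<le> n" by simp
  moreover have "diag_disc n f \<noteq> 0" by (simp add: prod_zero_iff[OF fin])
  moreover have "diag_disc n f = 1" if "diag_rank n f = 0"
  proof -
    have "{i. i < n \<and> f i \<noteq> 0} = {}" using that card_0_eq[OF fin] by blast
    then show ?thesis by (simp only: prod.empty)
  qed
  ultimately show ?thesis
    unfolding rank_char_def using mat_diag_congruent_normal[OF odd, of n f]
    by (intro conjI exI[of _ "diag_disc n f"]) simp_all
qed

lemma rank_char_rank:
  fixes A :: "'a::{field,finite} mat"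
  assumes "rank_char n A k s"
  shows "vec_space.rank n A = k"
  using assms rank_congruent rank_mat_diag_normal unfolding rank_char_def by metis

lemma rank_char_unique:
  fixes A :: "'a::{field,finite} mat"
  assumes k: "rank_char n A k s" and l: "rank_char n A l t"
  shows "k = l \<and> s = t"
proof -
  have kl: "k = l" using rank_char_rank[OF k] rank_char_rank[OF l] by simp
  from k obtain d where d: "d \<noteq> 0" "k = 0 \<longrightarrow> d = 1" "psi d = s" "k \<le> n"
    "congruent_mat n A (mat_diag n (normal_entries k d))" unfolding rank_char_def by blast
  from l obtain e where e: "e \<noteq> 0" "k = 0 \<longrightarrow> e = 1" "psi e = t"
    "congruent_mat n A (mat_diag n (normal_entries k e))" unfolding rank_char_def kl by blast
  have "congruent_mat n (mat_diag n (normal_entries k d)) (mat_diag n (normal_entries k e))"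
    using congruent_mat_trans[OF congruent_mat_sym[OF d(5)] e(4)] .
  then have "k \<ge> 1 \<Longrightarrow> s = t" using psi_congruent_normal[OF _ d(4) d(1)] d(3) e(3) by blast
  then show ?thesis using kl d e by (cases "k = 0") auto
qed

text \<open>
  The last entry of the normal form may be replaced by any other element with the same character, as the two differ by
  a square. This allows the fixed nonsquare of the counting functions to be used.
\<close>

lemma rank_char_congruent_normal:
  fixes A :: "'a::{field,finite} mat"
  assumes odd: "odd CARD('a)" and "rank_char n A k s" and e: "e \<noteq> 0" "psi e = s"
  shows "congruent_mat n A (mat_diag n (normal_entries k e))"
proof -
  from assms obtain d where d: "d \<noteq> 0" "psi d = s" "k \<le> n"
    "congruent_mat n A (mat_diag n (normal_entries k d))" unfolding rank_char_def by blast
  have "psi (d * e) = psi d * psi e" using psi_mult[OF odd d(1) e(1)] .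
  then have "psi (d * e) = 1" using d(2) e(2) psi_cases[of d] by auto
  then obtain t where t: "d * e = t\<^sup>2" unfolding psi_def is_sq_def by (metis one_neq_neg_one)
  then have e_eq: "e = d * (t / d)\<^sup>2" and t0: "t / d \<noteq> 0"
    using d(1) e(1) by (auto simp: field_simps power2_eq_square)
  show ?thesis
  proof (cases "k = 0")
    case True
    then have "normal_entries k e = normal_entries k d" by (auto simp: normal_entries_def)
    then show ?thesis using d(4) by simp
  next
    case False
    have "(normal_entries k d)(k - 1 := normal_entries k d (k - 1) * (t / d)\<^sup>2) = normal_entries k e"
      using False e_eq by (intro ext) (auto simp: normal_entries_def)
    then have "congruent_mat n (mat_diag n (normal_entries k e)) (mat_diag n (normal_entries k d))"
      using congruent_diag_scale[of "k - 1" n "t / d" "normal_entries k d"] False d(3) t0 by simp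
    then show ?thesis using congruent_mat_trans[OF d(4)] congruent_mat_sym by blast
  qed
qed

lemma mat_diag_normal_0: "mat_diag n (normal_entries 0 d) = (0\<^sub>m n n :: 'a::field mat)"
  by (rule eq_matI) (auto simp: normal_entries_def)

lemma rank_char_iff:
  fixes A :: "'a::{field,finite} mat"
  assumes odd: "odd CARD('a)" and A: "A \<in> carrier_mat n n"
  shows "rank_char n A k s \<longleftrightarrow> vec_space.rank n A = k \<and> has_character n A s"
proof
  assume rc: "rank_char n A k s"
  have rank: "vec_space.rank n A = k" by (rule rank_char_rank[OF rc])
  have "has_character n A s"
  proof (cases "A = 0\<^sub>m n n")
    case True
    then have "k = 0" using rank vec_space.rank_0I by metis
    then show ?thesis using rc True by (auto simp: rank_char_def has_character_def)
  next
    case False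
    from rc obtain d :: 'a where d: "d \<noteq> 0" "psi d = s" unfolding rank_char_def by blast
    define e where "e = (if is_sq d then 1 else d)"
    have e: "e \<noteq> 0" "psi e = s" "e = 1 \<or> \<not> is_sq e"
      using d unfolding e_def by (auto simp: psi_def[of d])
    from rank_char_congruent_normal[OF odd rc e(1,2)] obtain P
      where "P \<in> carrier_mat n n" "invertible_mat P" "A = P * diag_normal_form n k e * P\<^sup>T"
      unfolding congruent_mat_def diag_normal_form_eq by blast
    then have "\<exists>M d. M \<in> carrier_mat n n \<and> invertible_mat M \<and> (d = 1 \<or> \<not> is_sq d) \<and>
        A = M * diag_normal_form n k d * M\<^sup>T \<and> s = psi d"
      using e by (intro exI[of _ P] exI[of _ e]) simp
    then show ?thesis using False unfolding has_character_def rank by simp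
  qed
  with rank show "vec_space.rank n A = k \<and> has_character n A s" by blast
next
  assume asm: "vec_space.rank n A = k \<and> has_character n A s"
  show "rank_char n A k s"
  proof (cases "A = 0\<^sub>m n n")
    case True
    then have "k = 0" "s = 1" using asm vec_space.rank_0I by (metis, simp add: has_character_def)
    then show ?thesis
      unfolding rank_char_def using True A
      by (auto intro!: exI[of _ 1] simp: mat_diag_normal_0 congruent_mat_refl)
  next
    case False
    from asm False obtain M d where M: "M \<in> carrier_mat n n" "invertible_mat M"
      "d = 1 \<or> \<not> is_sq d" "A = M * mat_diag n (normal_entries k d) * M\<^sup>T" "s = psi d"
      unfolding has_character_def diag_normal_form_eq by auto
    have "d \<noteq> 0" using M(3) by auto
    moreover have "k \<noteq> 0" using M(1,4) False mat_diag_normal_0[of n d] by auto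
    moreover have "k \<le> n" using asm vec_space.rank_le_nc[OF A] by simp
    moreover have "congruent_mat n A (mat_diag n (normal_entries k d))"
      using M by (intro congruent_matI[of M]) auto
    ultimately show ?thesis unfolding rank_char_def using M(5) by auto
  qed
qed

section \<open>Bordering a normal form\<close>

text \<open>
  The base change that adds \<open>y l\<close> times the basis vector with index \<open>i\<close> to the one with index \<open>l\<close>.
\<close>

definition shear_mat :: "nat \<Rightarrow> nat \<Rightarrow> (nat \<Rightarrow> 'a::field) \<Rightarrow> 'a mat" where
  "shear_mat n i y = mat n n (\<lambda>(l, m). (if l = m then 1 else 0) + (if m = i then y l else 0))"

lemma shear_mat_carrier [simp]: "shear_mat n i y \<in> carrier_mat n n"
  "dim_row (shear_mat n i y) = n" "dim_col (shear_mat n i y) = n"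
  by (simp_all add: shear_mat_def)

lemma sum_shear_row:
  fixes y :: "'a::field" and l i n :: nat
  assumes "l < n" "i < n"
  shows "(\<Sum>t = 0..<n. ((if l = t then 1 else 0) + (if t = i then y else 0)) * g t) = g l + y * g i"
proof -
  have "(\<Sum>t = 0..<n. ((if l = t then 1 else 0) + (if t = i then y else 0)) * g t)
      = (\<Sum>t = 0..<n. (if l = t then g t else 0) + (if t = i then y * g t else 0))"
    by (intro sum.cong) (auto simp: algebra_simps)
  then show ?thesis using assms by (simp add: sum.distrib)
qed

lemma shear_mat_invertible:
  assumes i: "i < n" and y: "y i = (0::'a::field)"
  shows "invertible_mat (shear_mat n i y)"
proof -
  have "shear_mat n i y * shear_mat n i (\<lambda>l. - y l) = 1\<^sub>m n"
  proof (rule eq_matI)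
    fix l m assume "l < dim_row (1\<^sub>m n :: 'a mat)" "m < dim_col (1\<^sub>m n :: 'a mat)"
    then have lm: "l < n" "m < n" by auto
    let ?g = "\<lambda>t. (if t = m then 1 else 0) + (if m = i then - y t else 0)"
    have "(shear_mat n i y * shear_mat n i (\<lambda>l. - y l)) $$ (l, m)
        = (\<Sum>t = 0..<n. ((if l = t then 1 else 0) + (if t = i then y l else 0)) * ?g t)"
      using lm by (simp add: shear_mat_def scalar_prod_def)
    also have "\<dots> = ?g l + y l * ?g i" by (rule sum_shear_row[OF lm(1) i])
    also have "\<dots> = 1\<^sub>m n $$ (l, m)" using lm y by auto
    finally show "(shear_mat n i y * shear_mat n i (\<lambda>l. - y l)) $$ (l, m) = 1\<^sub>m n $$ (l, m)" .
  qed auto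
  then show ?thesis by (intro invertible_matI[of _ n]) auto
qed

text \<open>
  Adding multiples of a basis vector of the radical to the others does not change the form.
\<close>

lemma shear_mat_fixes_diag:
  assumes "f i = (0::'a::field)"
  shows "shear_mat n i y * mat_diag n f * (shear_mat n i y)\<^sup>T = mat_diag n f"
proof -
  have 1: "shear_mat n i y * mat_diag n f = mat_diag n f"
    unfolding mat_diag_mult_right[OF shear_mat_carrier(1)]
    using assms by (intro eq_matI) (auto simp: shear_mat_def)
  then have "(shear_mat n i y * mat_diag n f)\<^sup>T = mat_diag n f" by simp
  then have "mat_diag n f * (shear_mat n i y)\<^sup>T = mat_diag n f"
    by (subst (asm) transpose_mult[of _ n n _ n]) auto
  with 1 show ?thesis by simp
qed

text \<open>
  The old basis vector \<open>e\<close> with index \<open>i\<close> lies in the radical of the diagonal form, but not in that of the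
  bordered form. Subtracting multiples of it from the other basis vectors makes these orthogonal to the new vector
  \<open>f\<close>. Then \<open>e\<close> and \<open>f\<close> span a hyperbolic plane, for which \<open>f + e\<close> and \<open>f - e\<close> are an
  orthogonal basis.
\<close>

lemma border_diag_split_plane:
  fixes f :: "nat \<Rightarrow> 'a::field"
  assumes two: "(2::'a) \<noteq> 0" and u: "u \<in> carrier_vec n" and i: "i < n" and fi: "f i = 0" and ui: "u $ i \<noteq> 0"
  shows "congruent_mat (Suc n) (border n (mat_diag n f) u 0)
           (mat_diag (Suc n) (f(i := 2 * u $ i, n := - (2 * u $ i))))"
proof -
  let ?a = "u $ i" and ?D = "mat_diag n f"
  define y where "y l = (if l = i then 0 else u $ l / ?a)" for l
  let ?E = "shear_mat n i y" and ?e = "?a \<cdot>\<^sub>v unit_vec n i"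
  have y: "y i = 0" by (simp add: y_def)
  have "?E *\<^sub>v ?e = u"
  proof (rule eq_vecI)
    fix l assume "l < dim_vec u"
    then have l: "l < n" using u by auto
    have "(?E *\<^sub>v ?e) $ l
        = (\<Sum>t = 0..<n. ((if l = t then 1 else 0) + (if t = i then y l else 0)) * ?e $ t)"
      using l by (simp add: shear_mat_def scalar_prod_def)
    also have "\<dots> = ?e $ l + y l * ?e $ i" by (rule sum_shear_row[OF l i])
    also have "\<dots> = u $ l" using l i ui by (auto simp: y_def)
    finally show "(?E *\<^sub>v ?e) $ l = u $ l" .
  qed (use u in auto)
  then have 1: "congruent_mat (Suc n) (border n ?D u 0) (border n ?D ?e 0)"
    using border_congruent[OF shear_mat_carrier(1) shear_mat_invertible[of i n y, OF i y] mat_diag_dim, of ?e f 0]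
    by (simp add: shear_mat_fixes_diag[where f = f and i = i, OF fi])
  let ?A = "border n ?D ?e 0" and ?B = "mat_diag (Suc n) (f(i := 2 * ?a, n := - (2 * ?a)))"
  have idx: "?A $$ (l, m) = (if l < n then if m < n then if l = m then f m else 0
      else if l = i then ?a else 0 else if m < n then if m = i then ?a else 0 else 0)"
    if "l < Suc n" "m < Suc n" for l m
    using that i by (subst index_border) (auto simp: unit_vec_def)
  have A: "?A \<in> carrier_mat (Suc n) (Suc n)" by simp
  then have dim: "dim_row ?A = Suc n" "dim_col ?A = Suc n" by (rule carrier_matD)+
  have "congruent_mat (Suc n) ?B ?A"
  \<comment> \<open>The new basis vectors are \<open>e + f\<close> and \<open>f - e\<close>, of lengths \<open>2 * u $ i\<close> and minus that.\<close>
  proof (rule congruent_plane_mat[of i _ n 1 1 1 "- 1"])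
    show "?A\<^sup>T = ?A"
      by (rule eq_matI) (use i in \<open>auto simp: idx dim\<close>)
    show "(1::'a) * 1 - 1 * - 1 \<noteq> 0" using two by simp
    fix l assume "l < Suc n" "l \<noteq> i" "l \<noteq> n"
    then show "?A $$ (l, i) = 0 \<and> ?A $$ (l, n) = 0" using i by (simp add: idx)
  next
    fix l m assume "l < Suc n" "m < Suc n" "l \<noteq> i" "l \<noteq> n"
    then show "?B $$ (l, m) = ?A $$ (l, m)" using i by (simp add: idx)
  qed (use i fi in \<open>auto simp: idx\<close>)
  then show ?thesis using congruent_mat_trans[OF 1] congruent_mat_sym by blast
qed

lemma rank_char_normal_extended:
  fixes d :: "'a::{field,finite}"
  assumes odd: "odd CARD('a)" and d: "d \<noteq> 0" "k = 0 \<longrightarrow> d = 1" and k: "k \<le> n"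
    and J: "finite J" "J \<subseteq> {k..<n}" "\<And>j. j \<in> J \<Longrightarrow> g j \<noteq> 0"
  shows "rank_char n (mat_diag n (\<lambda>i. if i \<in> J then g i else normal_entries k d i))
           (k + card J) (psi (d * (\<Prod>j\<in>J. g j)))"
proof -
  let ?f = "\<lambda>i. if i \<in> J then g i else normal_entries k d i"
  have set: "{i. i < n \<and> ?f i \<noteq> 0} = {..<k} \<union> J"
    using d(1) k J by (auto simp: normal_entries_def)
  have disj: "{..<k} \<inter> J = {}" using J(2) by auto
  have "(\<Prod>i<k. ?f i) = (\<Prod>i<k. normal_entries k d i)" using J(2) by (intro prod.cong) auto
  moreover have "(\<Prod>i\<in>J. ?f i) = (\<Prod>j\<in>J. g j)" by (intro prod.cong) auto
  ultimately have "diag_disc n ?f = d * (\<Prod>j\<in>J. g j)"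
    unfolding set using disj J(1) prod_normal_entries[OF d(2)] by (simp add: prod.union_disjoint)
  moreover have "diag_rank n ?f = k + card J"
    unfolding set using disj J(1) by (simp add: card_Un_disjoint)
  ultimately show ?thesis using rank_char_diag[OF odd, of n ?f] by simp
qed

text \<open>
  A border outside the column space adds a hyperbolic plane, of rank 2 and discriminant -1 up to squares.
\<close>

lemma rank_char_border_outside:
  fixes d :: "'a::{field,finite}"
  assumes odd: "odd CARD('a)" and d: "d \<noteq> 0" "k = 0 \<longrightarrow> d = 1" and k: "k \<le> n"
    and u: "u \<in> carrier_vec n" and i: "k \<le> i" "i < n" "u $ i \<noteq> 0"
  shows "rank_char (Suc n) (border n (mat_diag n (normal_entries k d)) u 0) (k + 2) (psi d * psi (- 1 :: 'a))"
proof -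
  let ?a = "2 * u $ i" and ?f = "normal_entries k d"
  have a: "?a \<noteq> 0" using two_neq_0_field[OF odd] i(3) by simp
  have fi: "?f i = 0" using i by (simp add: normal_entries_def)
  let ?g = "\<lambda>j. if j = i then ?a else - ?a"
  have "rank_char (Suc n) (mat_diag (Suc n) (\<lambda>j. if j \<in> {i, n} then ?g j else ?f j))
      (k + card {i, n}) (psi (d * (\<Prod>j\<in>{i, n}. ?g j)))"
    by (rule rank_char_normal_extended[OF odd d]) (use k i a in auto)
  moreover have "(\<lambda>j. if j \<in> {i, n} then ?g j else ?f j) = ?f(i := ?a, n := - ?a)"
    using i by auto
  moreover have "psi (d * (\<Prod>j\<in>{i, n}. ?g j)) = psi d * psi (- 1 :: 'a)"
  proof -
    have eq: "d * (\<Prod>j\<in>{i, n}. ?g j) = d * (- 1) * ?a\<^sup>2" using i by (simp add: power2_eq_square)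
    have "psi (d * (\<Prod>j\<in>{i, n}. ?g j)) = psi (d * (- 1))"
      unfolding eq by (rule psi_mult_square[OF a])
    then show ?thesis using psi_mult[OF odd d(1), of "- 1"] by simp
  qed
  ultimately have "rank_char (Suc n) (mat_diag (Suc n) (?f(i := ?a, n := - ?a))) (k + 2) (psi d * psi (- 1 :: 'a))"
    using i by simp
  then show ?thesis
    using rank_char_congruent
      border_diag_split_plane[where f = ?f and i = i, OF two_neq_0_field[OF odd] u i(2) fi i(3)] by blast
qed

text \<open>
  The quadratic form whose Gram matrix is the nonzero part of the normal form.
\<close>

definition quad_form :: "nat \<Rightarrow> 'a::field \<Rightarrow> 'a vec \<Rightarrow> 'a" where
  "quad_form k d x = (\<Sum>i<k. normal_entries k d i * (x $ i)\<^sup>2)"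

text \<open>
  A border inside the column space splits off the one-dimensional form with value minus \<open>quad_form k d w\<close>.
\<close>

lemma rank_char_border_inside:
  fixes d :: "'a::{field,finite}"
  assumes odd: "odd CARD('a)" and d: "d \<noteq> 0" "k = 0 \<longrightarrow> d = 1" and k: "k \<le> n"
    and w: "w \<in> carrier_vec n"
  defines "D \<equiv> mat_diag n (normal_entries k d)"
  shows "if quad_form k d w = 0 then rank_char (Suc n) (border n D (D *\<^sub>v w) 0) k (psi d)
         else rank_char (Suc n) (border n D (D *\<^sub>v w) 0) (k + 1) (psi d * psi (- quad_form k d w))"
proof -
  let ?f = "normal_entries k d" and ?q = "quad_form k d w"
  have "w \<bullet> (D *\<^sub>v w) = (\<Sum>i = 0..<n. w $ i * (?f i * w $ i))"
    unfolding scalar_prod_def D_def using w by (simp add: mat_diag_mult_vec del: index_mult_mat_vec)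
  also have "\<dots> = (\<Sum>i<k. w $ i * (?f i * w $ i))"
    using k by (intro sum.mono_neutral_right) (auto simp: normal_entries_def)
  also have "\<dots> = ?q" unfolding quad_form_def by (intro sum.cong) (auto simp: power2_eq_square ac_simps)
  finally have q: "w \<bullet> (D *\<^sub>v w) = ?q" .
  have D: "D \<in> carrier_mat n n" "D\<^sup>T = D" by (simp_all add: D_def)
  have cong: "congruent_mat (Suc n) (border n D (D *\<^sub>v w) 0) (mat_diag (Suc n) (?f(n := - ?q)))"
    using border_schur_congruent[OF D w, of 0] q unfolding D_def border_zero_diag by simp
  show ?thesis
  proof (cases "?q = 0")
    case True
    have "?f(n := 0) = ?f" using k by (intro ext) (auto simp: normal_entries_def)
    then show ?thesis
      using True cong rank_char_normal_extended[OF odd d, of "Suc n" "{}" "\<lambda>_. 1"] k rank_char_congruent by auto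
  next
    case False
    have "rank_char (Suc n) (mat_diag (Suc n) (\<lambda>j. if j \<in> {n} then - ?q else ?f j))
        (k + card {n}) (psi (d * (\<Prod>j\<in>{n}. - ?q)))"
      by (rule rank_char_normal_extended[OF odd d]) (use k False in auto)
    moreover have "(\<lambda>j. if j \<in> {n} then - ?q else ?f j) = ?f(n := - ?q)" by auto
    ultimately have "rank_char (Suc n) (mat_diag (Suc n) (?f(n := - ?q))) (k + 1) (psi d * psi (- ?q))"
      using psi_mult[OF odd d(1), of "- ?q"] False by simp
    then show ?thesis using False cong rank_char_congruent by simp
  qed
qed

section \<open>Bordering a hollow symmetric matrix\<close>

lemma invertible_mat_bij_betw:
  fixes M :: "'a::field mat"
  assumes M: "M \<in> carrier_mat n n" "invertible_mat M"
  shows "bij_betw (\<lambda>x. M *\<^sub>v x) (carrier_vec n) (carrier_vec n)"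
proof -
  from invertible_matE[OF M] obtain Q
    where Q: "Q \<in> carrier_mat n n" "M * Q = 1\<^sub>m n" "Q * M = 1\<^sub>m n" by blast
  show ?thesis
  proof (rule bij_betw_byWitness[where f' = "\<lambda>x. Q *\<^sub>v x"])
    show "\<forall>x\<in>carrier_vec n. Q *\<^sub>v (M *\<^sub>v x) = x"
      using M Q by (simp add: assoc_mult_mat_vec[symmetric, of _ n n _ n])
    show "\<forall>x\<in>carrier_vec n. M *\<^sub>v (Q *\<^sub>v x) = x"
      using M Q by (simp add: assoc_mult_mat_vec[symmetric, of _ n n _ n])
  qed (use M Q in auto)
qed

text \<open>
  Rank and character after bordering the normal form of rank \<open>k\<close> by a vector with coordinates \<open>w\<close>.
\<close>

definition border_type :: "nat \<Rightarrow> nat \<Rightarrow> 'a::field \<Rightarrow> 'a vec \<Rightarrow> nat \<times> int" where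
  "border_type n k d w =
     (if \<exists>i. k \<le> i \<and> i < n \<and> w $ i \<noteq> 0 then (k + 2, psi d * psi (- 1 :: 'a))
      else if quad_form k d w = 0 then (k, psi d)
      else (k + 1, psi d * psi (- quad_form k d w)))"

text \<open>
  The matrix \<open>E\<close> is the normal form made invertible by ones on the radical. In the coordinates \<open>w\<close> the border
  lies in the column space exactly if \<open>w\<close> vanishes from position \<open>k\<close> on, and then the value that decides about the
  rank is \<open>quad_form k d w\<close> itself, with \<open>d\<close> rather than its inverse.
\<close>

lemma rank_char_border_normal:
  fixes d :: "'a::{field,finite}"
  assumes odd: "odd CARD('a)" and d: "d \<noteq> 0" "k = 0 \<longrightarrow> d = 1" and k: "k \<le> n"
    and w: "w \<in> carrier_vec n"
  defines "D \<equiv> mat_diag n (normal_entries k d)"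
    and "E \<equiv> mat_diag n (\<lambda>i. if i + 1 = k then d else 1)"
  shows "rank_char (Suc n) (border n D (E *\<^sub>v w) 0) (fst (border_type n k d w)) (snd (border_type n k d w))"
proof (cases "\<exists>i. k \<le> i \<and> i < n \<and> w $ i \<noteq> 0")
  case True
  then obtain i where i: "k \<le> i" "i < n" "w $ i \<noteq> 0" by blast
  have "(E *\<^sub>v w) $ i \<noteq> 0" unfolding E_def using i mat_diag_mult_vec[OF w i(2)] by simp
  moreover have "E *\<^sub>v w \<in> carrier_vec n" unfolding E_def by (auto intro!: carrier_vecI)
  ultimately show ?thesis
    using True rank_char_border_outside[OF odd d k _ i(1,2)] unfolding border_type_def D_def by simp
next
  case False
  have "E *\<^sub>v w = D *\<^sub>v w"
  proof (rule eq_vecI)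
    fix i assume "i < dim_vec (D *\<^sub>v w)"
    then have i: "i < n" by (simp add: D_def)
    show "(E *\<^sub>v w) $ i = (D *\<^sub>v w) $ i"
      unfolding E_def D_def mat_diag_mult_vec[OF w i] using False i by (auto simp: normal_entries_def)
  qed (simp add: D_def E_def)
  then show ?thesis
    using False rank_char_border_inside[OF odd d k w] unfolding border_type_def D_def by auto
qed

text \<open>
  Diagonalising \<open>B\<close> gives coordinates on the possible borders in which the effect of bordering is explicit.
\<close>

lemma rank_char_border_param:
  fixes B :: "'a::{field,finite} mat" and d :: 'a
  assumes odd: "odd CARD('a)" and d: "d \<noteq> 0" "k = 0 \<longrightarrow> d = 1"
    and B: "rank_char n B k (psi d)"
  shows "\<exists>\<phi>. bij_betw \<phi> (carrier_vec n) (carrier_vec n) \<and>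
    (\<forall>w \<in> carrier_vec n. \<forall>m s. rank_char (Suc n) (border n B (\<phi> w) 0) m s \<longleftrightarrow> (m, s) = border_type n k d w)"
proof -
  let ?D = "mat_diag n (normal_entries k d)" and ?e = "\<lambda>i. if i + 1 = k then d else 1"
  let ?E = "mat_diag n ?e"
  have k: "k \<le> n" using B unfolding rank_char_def by blast
  have "?E * mat_diag n (\<lambda>i. inverse (?e i)) = mat_diag n (\<lambda>_. 1)"
    unfolding mat_diag_diag using d(1) by (intro mat_diag_cong) simp
  then have E: "invertible_mat ?E"
    by (intro invertible_matI[of _ n "mat_diag n (\<lambda>i. inverse (?e i))"]) (auto simp del: mat_diag_diag)
  from rank_char_congruent_normal[OF odd B d(1) refl] obtain P
    where P: "P \<in> carrier_mat n n" "invertible_mat P" "B = P * ?D * P\<^sup>T"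
    unfolding congruent_mat_def by blast
  let ?\<phi> = "\<lambda>w. P *\<^sub>v (?E *\<^sub>v w)"
  have "bij_betw ((\<lambda>x. P *\<^sub>v x) \<circ> (\<lambda>x. ?E *\<^sub>v x)) (carrier_vec n) (carrier_vec n)"
    by (rule bij_betw_trans[OF invertible_mat_bij_betw[OF mat_diag_dim E] invertible_mat_bij_betw[OF P(1,2)]])
  then have "bij_betw ?\<phi> (carrier_vec n) (carrier_vec n)" by (simp add: comp_def)
  moreover have "rank_char (Suc n) (border n B (?\<phi> w) 0) m s \<longleftrightarrow> (m, s) = border_type n k d w"
    if w: "w \<in> carrier_vec n" for w m s
  proof -
    have "?E *\<^sub>v w \<in> carrier_vec n" by (auto intro!: carrier_vecI)
    from border_congruent[OF P(1,2) mat_diag_dim this, of "normal_entries k d" 0]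
    have "congruent_mat (Suc n) (border n B (?\<phi> w) 0) (border n ?D (?E *\<^sub>v w) 0)"
      unfolding P(3) .
    from rank_char_congruent[OF this rank_char_border_normal[OF odd d k w]]
    have "rank_char (Suc n) (border n B (?\<phi> w) 0) (fst (border_type n k d w)) (snd (border_type n k d w))" .
    then show ?thesis using rank_char_unique by (metis prod.collapse fst_conv snd_conv)
  qed
  ultimately show ?thesis by blast
qed

lemma card_border_type:
  fixes B :: "'a::{field,finite} mat" and d :: 'a
  assumes odd: "odd CARD('a)" and d: "d \<noteq> 0" "k = 0 \<longrightarrow> d = 1"
    and B: "rank_char n B k (psi d)"
  shows "card {v \<in> carrier_vec n. rank_char (Suc n) (border n B v 0) m s}
       = card {w \<in> carrier_vec n. border_type n k d w = (m, s)}"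
proof -
  from rank_char_border_param[OF assms] obtain \<phi>
    where bij: "bij_betw \<phi> (carrier_vec n) (carrier_vec n)"
      and \<phi>: "\<And>w. w \<in> carrier_vec n \<Longrightarrow>
        rank_char (Suc n) (border n B (\<phi> w) 0) m s \<longleftrightarrow> (m, s) = border_type n k d w"
    by blast
  have "bij_betw \<phi> {w \<in> carrier_vec n. border_type n k d w = (m, s)}
      {v \<in> carrier_vec n. rank_char (Suc n) (border n B v 0) m s}"
  proof (rule bij_betw_subset[OF bij])
    show "\<phi> ` {w \<in> carrier_vec n. border_type n k d w = (m, s)}
        = {v \<in> carrier_vec n. rank_char (Suc n) (border n B v 0) m s}"
    proof
      show "{v \<in> carrier_vec n. rank_char (Suc n) (border n B v 0) m s}
          \<subseteq> \<phi> ` {w \<in> carrier_vec n. border_type n k d w = (m, s)}"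
      proof
        fix v assume v: "v \<in> {v \<in> carrier_vec n. rank_char (Suc n) (border n B v 0) m s}"
        then obtain w where w: "w \<in> carrier_vec n" "v = \<phi> w"
          using bij unfolding bij_betw_def by blast
        then have "border_type n k d w = (m, s)" using v \<phi>[OF w(1)] by simp
        then show "v \<in> \<phi> ` {w \<in> carrier_vec n. border_type n k d w = (m, s)}" using w by blast
      qed
    next
      show "\<phi> ` {w \<in> carrier_vec n. border_type n k d w = (m, s)}
          \<subseteq> {v \<in> carrier_vec n. rank_char (Suc n) (border n B v 0) m s}"
      proof (rule image_subsetI)
        fix w assume w: "w \<in> {w \<in> carrier_vec n. border_type n k d w = (m, s)}"
        then have "\<phi> w \<in> carrier_vec n" using bij unfolding bij_betw_def by blast
        then show "\<phi> w \<in> {v \<in> carrier_vec n. rank_char (Suc n) (border n B v 0) m s}"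
          using w \<phi>[of w] by simp
      qed
    qed
  qed blast
  then show ?thesis by (simp add: bij_betw_same_card)
qed

definition hollow_sym :: "nat \<Rightarrow> 'a::field mat set" where
  "hollow_sym n = {A. A \<in> carrier_mat n n \<and> A\<^sup>T = A \<and> (\<forall>i<n. A $$ (i, i) = 0)}"

lemma hollow_sym_border_bij:
  "bij_betw (\<lambda>(B, v). border n B v 0) (hollow_sym n \<times> carrier_vec n) (hollow_sym (Suc n) :: 'a::field mat set)"
proof (rule bij_betw_byWitness[where f' = "\<lambda>A. (mat n n (\<lambda>ij. A $$ ij), vec n (\<lambda>i. A $$ (i, n)))"])
  have sym: "A $$ (i, j) = A $$ (j, i)" if "A \<in> hollow_sym m" "i < m" "j < m" for A :: "'a mat" and i j m
    using that unfolding hollow_sym_def by (metis (mono_tags, lifting) mem_Collect_eq carrier_matD index_transpose_mat(1))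
  show "\<forall>p \<in> hollow_sym n \<times> carrier_vec n.
      (\<lambda>A. (mat n n (\<lambda>ij. A $$ ij), vec n (\<lambda>i. A $$ (i, n)))) ((\<lambda>(B, v). border n B v 0) p) = (p :: 'a mat \<times> 'a vec)"
  proof
    fix p :: "'a mat \<times> 'a vec" assume "p \<in> hollow_sym n \<times> carrier_vec n"
    then obtain B v where p: "p = (B, v)" "B \<in> carrier_mat n n" "v \<in> carrier_vec n"
      unfolding hollow_sym_def by auto
    have "mat n n (\<lambda>ij. border n B v 0 $$ ij) = B"
      using p by (intro eq_matI) (auto simp: index_border)
    moreover have "vec n (\<lambda>i. border n B v 0 $$ (i, n)) = v"
      using p by (intro eq_vecI) (auto simp: index_border)
    ultimately show "(\<lambda>A. (mat n n (\<lambda>ij. A $$ ij), vec n (\<lambda>i. A $$ (i, n)))) ((\<lambda>(B, v). border n B v 0) p) = p"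
      unfolding p by simp
  qed
  show "\<forall>A \<in> hollow_sym (Suc n). (\<lambda>(B, v). border n B v 0) (mat n n (\<lambda>ij. A $$ ij), vec n (\<lambda>i. A $$ (i, n))) = (A :: 'a mat)"
  proof
    fix A :: "'a mat" assume A: "A \<in> hollow_sym (Suc n)"
    then have "A \<in> carrier_mat (Suc n) (Suc n)" "A $$ (n, n) = 0" unfolding hollow_sym_def by auto
    then have Ac: "dim_row A = Suc n" "dim_col A = Suc n" and A0: "A $$ (n, n) = 0" by auto
    let ?X = "border n (mat n n (\<lambda>ij. A $$ ij)) (vec n (\<lambda>i. A $$ (i, n))) 0"
    have "?X \<in> carrier_mat (Suc n) (Suc n)" by simp
    then have X: "dim_row ?X = Suc n" "dim_col ?X = Suc n" by (rule carrier_matD)+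
    have "?X = A"
    proof (rule eq_matI)
      fix i j assume "i < dim_row A" "j < dim_col A"
      then have ij: "i < Suc n" "j < Suc n" using Ac by auto
      then have "?X $$ (i, j) = (if i < n then if j < n then A $$ (i, j) else A $$ (i, n)
          else if j < n then A $$ (j, n) else 0)"
        by (subst index_border) auto
      also have "\<dots> = A $$ (i, j)"
        using ij A0 sym[OF A, of j n] by (auto simp: less_Suc_eq)
      finally show "?X $$ (i, j) = A $$ (i, j)" .
    qed (simp_all only: X Ac)
    then show "(\<lambda>(B, v). border n B v 0) (mat n n (\<lambda>ij. A $$ ij), vec n (\<lambda>i. A $$ (i, n))) = A" by simp
  qed
  show "(\<lambda>(B, v). border n B v 0) ` (hollow_sym n \<times> carrier_vec n) \<subseteq> (hollow_sym (Suc n) :: 'a mat set)"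
  proof (clarify)
    fix B :: "'a mat" and v :: "'a vec" assume B: "B \<in> hollow_sym n" and v: "v \<in> carrier_vec n"
    have Bc: "B \<in> carrier_mat n n" and diag: "\<And>i. i < n \<Longrightarrow> B $$ (i, i) = 0"
      using B unfolding hollow_sym_def by auto
    have X: "border n B v 0 \<in> carrier_mat (Suc n) (Suc n)" using Bc by simp
    have "(border n B v 0)\<^sup>T = border n B v 0"
      using X sym[OF B] by (intro eq_matI) (auto simp: index_border[OF Bc v])
    then show "border n B v 0 \<in> hollow_sym (Suc n)"
      using X diag unfolding hollow_sym_def by (auto simp: index_border[OF Bc v])
  qed
  show "(\<lambda>A. (mat n n (\<lambda>ij. A $$ ij), vec n (\<lambda>i. A $$ (i, n)))) ` (hollow_sym (Suc n) :: 'a mat set)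
      \<subseteq> hollow_sym n \<times> carrier_vec n"
  proof (rule image_subsetI)
    fix A :: "'a mat" assume A: "A \<in> hollow_sym (Suc n)"
    then have "mat n n (\<lambda>ij. A $$ ij) \<in> hollow_sym n"
      using sym[OF A] unfolding hollow_sym_def by (auto intro!: eq_matI)
    then show "(mat n n (\<lambda>ij. A $$ ij), vec n (\<lambda>i. A $$ (i, n))) \<in> hollow_sym n \<times> carrier_vec n" by simp
  qed
qed

lemma finite_hollow_sym: "finite (hollow_sym n :: 'a::{field,finite} mat set)"
proof (induction n)
  case 0
  have "hollow_sym 0 \<subseteq> {0\<^sub>m 0 0 :: 'a mat}" unfolding hollow_sym_def by (auto intro!: eq_matI)
  then show ?case using finite_subset by blast
next
  case (Suc n)
  then have "finite (hollow_sym n \<times> carrier_vec n :: ('a mat \<times> 'a vec) set)" by simp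
  then show ?case using bij_betw_finite[OF hollow_sym_border_bij] by blast
qed

text \<open>
  The analysis of borders also shows, by induction on the size, that these matrices have a rank and a character at all.
\<close>

lemma hollow_sym_rank_char_exists:
  fixes A :: "'a::{field,finite} mat"
  assumes odd: "odd CARD('a)"
  shows "A \<in> hollow_sym n \<Longrightarrow> \<exists>k s. rank_char n A k s"
proof (induction n arbitrary: A)
  case 0
  then have "A = mat_diag 0 (\<lambda>_. 0)" unfolding hollow_sym_def by (auto intro!: eq_matI)
  then show ?case using rank_char_diag[OF odd] by blast
next
  case (Suc n)
  then have "A \<in> (\<lambda>(B, v). border n B v 0) ` (hollow_sym n \<times> carrier_vec n)"
    using hollow_sym_border_bij[of n] unfolding bij_betw_def by auto
  then obtain B v where Bv: "A = border n B v 0" "B \<in> hollow_sym n" "v \<in> carrier_vec n" by auto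
  from Suc.IH[OF Bv(2)] obtain k t where kt: "rank_char n B k t" by blast
  then obtain d :: 'a where d: "d \<noteq> 0" "k = 0 \<longrightarrow> d = 1" "psi d = t" unfolding rank_char_def by blast
  from rank_char_border_param[OF odd d(1,2)] kt d(3) obtain \<phi>
    where bij: "bij_betw \<phi> (carrier_vec n) (carrier_vec n)"
      and \<phi>: "\<And>w m s. w \<in> carrier_vec n \<Longrightarrow>
        rank_char (Suc n) (border n B (\<phi> w) 0) m s \<longleftrightarrow> (m, s) = border_type n k d w"
    by blast
  from Bv(3) bij obtain w where "w \<in> carrier_vec n" "v = \<phi> w" unfolding bij_betw_def by blast
  then show ?case using \<phi> Bv(1) by (metis prod.collapse)
qed

lemma sym0_eq_card_rank_char:
  assumes odd: "odd CARD('a::{field,finite})"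
  shows "sym0 TYPE('a) s n k = card {A \<in> hollow_sym n. rank_char n (A :: 'a mat) k s}"
  unfolding sym0_def hollow_sym_def
  by (rule arg_cong[of _ _ card]) (auto simp: rank_char_iff[OF odd])

section \<open>Counting borders\<close>

lemma quad_form_Suc:
  "quad_form (Suc m) d x = (\<Sum>i<m. (x $ i)\<^sup>2) + d * (x $ m)\<^sup>2"
  by (simp add: quad_form_def normal_entries_def)

lemma sq_eq_card_quad_form:
  assumes "m \<ge> 1"
  shows "sq z s m = card {x \<in> carrier_vec m. quad_form m (if s = 1 then 1 else z) x = 0}"
proof -
  obtain m' where "m = Suc m'" using assms by (cases m) auto
  then show ?thesis unfolding sq_def by (simp add: quad_form_Suc)
qed

lemma normal_entries_Suc_Suc: "normal_entries (Suc r) d (Suc i) = normal_entries r d i"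
  by (auto simp: normal_entries_def)

text \<open>
  The new square is added in front, because the entry \<open>d\<close> of the normal form stands at the last position.
\<close>

lemma quad_form_vCons:
  assumes "r \<ge> 1"
  shows "quad_form (Suc r) d (vCons t y) = t\<^sup>2 + quad_form r d y"
  using assms unfolding quad_form_def sum.lessThan_Suc_shift normal_entries_Suc_Suc
  by (simp add: normal_entries_def[of "Suc r"])

lemma sum_if_1_2_0:
  assumes "finite A"
  shows "(\<Sum>y\<in>A. if P y then 1 else if R y then 2 else 0 :: nat)
    = card {y \<in> A. P y} + 2 * card {y \<in> A. \<not> P y \<and> R y}"
proof -
  have "(\<Sum>y\<in>A. if P y then 1 else if R y then 2 else 0 :: nat)
      = (\<Sum>y\<in>A. (if P y then 1 else 0) + (if \<not> P y \<and> R y then 2 else 0))"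
    by (intro sum.cong) auto
  also have "\<dots> = (\<Sum>y | y \<in> A \<and> P y. 1) + (\<Sum>y | y \<in> A \<and> \<not> P y \<and> R y. 2)"
    unfolding sum.distrib using assms by (simp only: sum.inter_filter)
  finally show ?thesis by simp
qed

text \<open>
  A zero of the form with one more square is a vector \<open>y\<close> together with a square root of minus the value of the form
  at \<open>y\<close>; there are 1, 2 or 0 of these. This is where differences of two counts of zeros come from.
\<close>

lemma card_quad_form_Suc_zeros:
  fixes d :: "'a::{field,finite}"
  assumes odd: "odd CARD('a)" and r: "r \<ge> 1"
  shows "card {x \<in> carrier_vec (Suc r). quad_form (Suc r) d x = 0}
    = card {y \<in> carrier_vec r. quad_form r d y = 0}
      + 2 * card {y \<in> carrier_vec r. quad_form r d y \<noteq> 0 \<and> is_sq (- quad_form r d y)}"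
proof -
  let ?S = "SIGMA y : carrier_vec r. {t. t\<^sup>2 = - quad_form r d y}"
  have eq: "{x \<in> carrier_vec (Suc r). quad_form (Suc r) d x = 0} = (\<lambda>(y, t). vCons t y) ` ?S"
  proof
    show "{x \<in> carrier_vec (Suc r). quad_form (Suc r) d x = 0} \<subseteq> (\<lambda>(y, t). vCons t y) ` ?S"
    proof
      fix x assume x: "x \<in> {x \<in> carrier_vec (Suc r). quad_form (Suc r) d x = 0}"
      then obtain t y where ty: "x = vCons t y" "y \<in> carrier_vec r" using x by (cases x) auto
      then have "(y, t) \<in> ?S" using x quad_form_vCons[OF r, of d t y] by (simp add: eq_neg_iff_add_eq_0)
      then show "x \<in> (\<lambda>(y, t). vCons t y) ` ?S" using ty(1) by force
    qed
  qed (auto simp: quad_form_vCons[OF r])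
  have "inj_on (\<lambda>(y, t). vCons t y) ?S" by (auto simp: inj_on_def)
  then have "card {x \<in> carrier_vec (Suc r). quad_form (Suc r) d x = 0}
      = (\<Sum>y \<in> carrier_vec r. card {t. t\<^sup>2 = - quad_form r d y})"
    unfolding eq by (simp add: card_image card_SigmaI)
  also have "\<dots> = (\<Sum>y \<in> carrier_vec r. if quad_form r d y = 0 then 1
      else if is_sq (- quad_form r d y) then 2 else 0)"
    by (simp add: card_square_roots[OF odd] cong: sum.cong)
  finally show ?thesis by (simp only: sum_if_1_2_0[OF finite_carrier_vec])
qed

lemma card_quad_form_split:
  fixes d :: "'a::{field,finite}"
  shows "CARD('a) ^ r = card {y \<in> carrier_vec r. quad_form r d y = 0}
      + card {y \<in> carrier_vec r. quad_form r d y \<noteq> 0 \<and> is_sq (- quad_form r d y)}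
      + card {y \<in> carrier_vec r. quad_form r d y \<noteq> 0 \<and> \<not> is_sq (- quad_form r d y)}"
proof -
  let ?A = "{y \<in> carrier_vec r. quad_form r d y = 0}"
    and ?B = "{y \<in> carrier_vec r. quad_form r d y \<noteq> 0 \<and> is_sq (- quad_form r d y)}"
    and ?C = "{y \<in> carrier_vec r. quad_form r d y \<noteq> 0 \<and> \<not> is_sq (- quad_form r d y)}"
  have "CARD('a) ^ r = card (?A \<union> ?B \<union> ?C)"
    unfolding card_carrier_vec[symmetric] by (intro arg_cong[of _ _ card]) auto
  also have "\<dots> = card (?A \<union> ?B) + card ?C" by (rule card_Un_disjoint) auto
  also have "card (?A \<union> ?B) = card ?A + card ?B" by (rule card_Un_disjoint) auto
  finally show ?thesis .
qed

lemma card_quad_form_inside: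
  fixes d :: "'a::{field,finite}"
  assumes k: "k \<le> n"
  shows "card {w \<in> carrier_vec n. (\<forall>i. k \<le> i \<and> i < n \<longrightarrow> w $ i = 0) \<and> P (quad_form k d w)}
    = card {x \<in> carrier_vec k. P (quad_form k d x)}"
proof -
  let ?j = "\<lambda>x :: 'a vec. x @\<^sub>v 0\<^sub>v (n - k)"
  have nf: "quad_form k d (?j x) = quad_form k d x" if "x \<in> carrier_vec k" for x
    unfolding quad_form_def using that k by (intro sum.cong) auto
  have "bij_betw ?j {x \<in> carrier_vec k. P (quad_form k d x)}
      {w \<in> carrier_vec n. (\<forall>i. k \<le> i \<and> i < n \<longrightarrow> w $ i = 0) \<and> P (quad_form k d w)}"
    using bij_betw_append_zeros[OF k, where 'a = 'a] nf
    unfolding bij_betw_def by (auto simp: inj_on_def set_eq_iff image_iff) metis+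
  then show ?thesis by (simp add: bij_betw_same_card)
qed

lemma card_border_type_rank_plus_2:
  fixes d :: "'a::{field,finite}"
  assumes k: "k \<le> n"
  shows "card {w \<in> carrier_vec n. border_type n k d w = (k + 2, s)}
    = (if s = psi d * psi (- 1 :: 'a) then CARD('a) ^ n - CARD('a) ^ k else 0)"
proof (cases "s = psi d * psi (- 1 :: 'a)")
  case True
  let ?Z = "{w :: 'a vec. w \<in> carrier_vec n \<and> (\<forall>i. k \<le> i \<and> i < n \<longrightarrow> w $ i = 0)}"
  have "{w \<in> carrier_vec n. border_type n k d w = (k + 2, s)} = carrier_vec n - ?Z"
    using True by (auto simp: border_type_def split: if_splits)
  moreover have "card ?Z = CARD('a) ^ k"
    using bij_betw_same_card[OF bij_betw_append_zeros[OF k, where 'a = 'a]] by (simp add: card_carrier_vec)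
  moreover have "card (carrier_vec n - ?Z) = card (carrier_vec n :: 'a vec set) - card ?Z"
    by (rule card_Diff_subset) auto
  ultimately show ?thesis using True by (simp add: card_carrier_vec)
next
  case False
  then have "{w \<in> carrier_vec n. border_type n k d w = (k + 2, s)} = {}"
    by (auto simp: border_type_def split: if_splits)
  then show ?thesis using False by (simp only: card.empty if_False)
qed

lemma card_border_type_same_rank:
  fixes d :: "'a::{field,finite}"
  assumes k: "k \<le> n"
  shows "card {w \<in> carrier_vec n. border_type n k d w = (k, s)}
    = (if s = psi d then card {x \<in> carrier_vec k. quad_form k d x = 0} else 0)"
proof (cases "s = psi d")
  case True
  have "{w \<in> carrier_vec n. border_type n k d w = (k, s)}
      = {w \<in> carrier_vec n. (\<forall>i. k \<le> i \<and> i < n \<longrightarrow> w $ i = 0) \<and> quad_form k d w = 0}"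
    using True by (auto simp: border_type_def split: if_splits)
  then show ?thesis using True card_quad_form_inside[OF k, where P = "\<lambda>c. c = 0"] by simp
next
  case False
  then have "{w \<in> carrier_vec n. border_type n k d w = (k, s)} = {}"
    by (auto simp: border_type_def split: if_splits)
  then show ?thesis using False by (simp only: card.empty if_False)
qed

lemma card_border_type_rank_plus_1:
  fixes d :: "'a::{field,finite}"
  assumes k: "k \<le> n"
  shows "card {w \<in> carrier_vec n. border_type n k d w = (k + 1, s)}
    = card {x \<in> carrier_vec k. quad_form k d x \<noteq> 0 \<and> psi (- quad_form k d x) = s * psi d}"
proof -
  have sq: "psi d * psi d = 1" using psi_cases[of d] by auto
  have "psi d * e = s \<longleftrightarrow> e = s * psi d" for e using psi_cases[of d] by auto
  then have "{w \<in> carrier_vec n. border_type n k d w = (k + 1, s)}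
      = {w \<in> carrier_vec n. (\<forall>i. k \<le> i \<and> i < n \<longrightarrow> w $ i = 0) \<and>
          (quad_form k d w \<noteq> 0 \<and> psi (- quad_form k d w) = s * psi d)}"
    using sq by (auto simp: border_type_def split: if_splits)
  then show ?thesis
    using card_quad_form_inside[OF k, where P = "\<lambda>c. c \<noteq> 0 \<and> psi (- c) = s * psi d"] by simp
qed

section \<open>The recursion\<close>

lemma psi_eq_1_iff: "psi a = 1 \<longleftrightarrow> is_sq a"
  and psi_eq_minus_1_iff: "psi a = - 1 \<longleftrightarrow> \<not> is_sq a"
  by (simp_all add: psi_def)

text \<open>
  For rank \<open>r - 1\<close> the border must lie outside the column space. For rank \<open>r + 1\<close> it must be a zero of the
  quadratic form. For rank \<open>r\<close> minus the value of the form must be a nonzero square if the character is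
  to be kept, and a nonsquare if it is to be changed; both are counted through the zeros of the form with one more square.
\<close>

lemma card_hollow_extensions:
  fixes B :: "'a::{field,finite} mat" and z :: 'a
  assumes odd: "odd CARD('a)" and z: "\<not> is_sq z" and r: "r \<ge> 1" and s: "s \<in> {1, - 1}"
    and B: "rank_char n B k t"
  shows "rat_of_nat (card {v \<in> carrier_vec n. rank_char (Suc n) (border n B v 0) (r + 1) s}) =
      (rat_of_nat CARD('a) ^ n - rat_of_nat CARD('a) ^ (r - 1))
        * of_bool (rank_char n B (r - 1) (s * psi (- 1 :: 'a)))
    + rat_of_nat (sq z s (r + 1)) * of_bool (rank_char n B (r + 1) s)
    + 1 / 2 * (rat_of_nat (sq z s (r + 1)) - rat_of_nat (sq z s r)) * of_bool (rank_char n B r s)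
    + (rat_of_nat CARD('a) ^ r - 1 / 2 * (rat_of_nat (sq z (- s) (r + 1)) + rat_of_nat (sq z (- s) r)))
        * of_bool (rank_char n B r (- s))"
    (is "rat_of_nat (card ?V) = ?R")
proof -
  have ind: "rank_char n B l u \<longleftrightarrow> l = k \<and> u = t" for l u
    using rank_char_unique[OF B, of l u] B by blast
  define d where "d = (if t = 1 then 1 else z)"
  have k: "k \<le> n" using B unfolding rank_char_def by blast
  obtain d0 :: 'a where d0: "k = 0 \<longrightarrow> d0 = 1" "psi d0 = t" using B unfolding rank_char_def by blast
  then have t: "t = 1 \<or> t = - 1" using psi_cases[of d0] by auto
  have d: "d \<noteq> 0" "k = 0 \<longrightarrow> d = 1" "psi d = t"
    using z t d0 unfolding d_def by (auto simp: psi_def[of z])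
  have V: "card ?V = card {w \<in> carrier_vec n. border_type n k d w = (r + 1, s)}"
    using card_border_type[OF odd d(1,2), of n B "r + 1" s] B d(3) by simp
  have sq_d: "sq z t m = card {x \<in> carrier_vec m. quad_form m d x = 0}" if "m \<ge> 1" for m
    using sq_eq_card_quad_form[OF that, of z t] unfolding d_def .
  have sgn: "t = s \<Longrightarrow> s * t = 1" "t = - s \<Longrightarrow> s * t = - 1" using s by auto
  consider "r = k + 1" | "k = r" "t = s" | "k = r" "t = - s" | "k = r + 1" | "r + 1 \<notin> {k, k + 1, k + 2}"
    using t s by fastforce
  then show ?thesis
  proof cases
    case 1
    have "CARD('a) ^ k \<le> CARD('a) ^ n" using k by (intro power_increasing) auto
    moreover have "s = t * psi (- 1 :: 'a) \<longleftrightarrow> s * psi (- 1 :: 'a) = t"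
      using psi_cases[of "- 1 :: 'a"] by auto
    moreover have "card ?V = (if s = t * psi (- 1 :: 'a) then CARD('a) ^ n - CARD('a) ^ k else 0)"
      unfolding V using card_border_type_rank_plus_2[OF k, of d s] 1 d(3) by simp
    ultimately show ?thesis unfolding ind using 1 by (simp add: of_nat_diff)
  next
    case 2
    have "card ?V = card {x \<in> carrier_vec r. quad_form r d x \<noteq> 0 \<and> is_sq (- quad_form r d x)}"
      unfolding V using card_border_type_rank_plus_1[OF k, of d s] sgn(1)[OF 2(2)] 2(1) d(3)
      by (simp add: psi_eq_1_iff)
    moreover have "sq z s (r + 1) = sq z s r
        + 2 * card {x \<in> carrier_vec r. quad_form r d x \<noteq> 0 \<and> is_sq (- quad_form r d x)}"
      using sq_d[of "r + 1"] sq_d[of r] card_quad_form_Suc_zeros[OF odd r, of d] r 2 by simp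
    ultimately show ?thesis unfolding ind using 2 s r by auto
  next
    case 3
    have "card ?V = card {x \<in> carrier_vec r. quad_form r d x \<noteq> 0 \<and> \<not> is_sq (- quad_form r d x)}"
      unfolding V using card_border_type_rank_plus_1[OF k, of d s] sgn(2)[OF 3(2)] 3(1) d(3)
      by (simp add: psi_eq_minus_1_iff)
    moreover have "sq z (- s) (r + 1) = sq z (- s) r
        + 2 * card {x \<in> carrier_vec r. quad_form r d x \<noteq> 0 \<and> is_sq (- quad_form r d x)}"
      using sq_d[of "r + 1"] sq_d[of r] card_quad_form_Suc_zeros[OF odd r, of d] r 3 by simp
    moreover have "rat_of_nat CARD('a) ^ r = rat_of_nat (sq z (- s) r)
        + rat_of_nat (card {x \<in> carrier_vec r. quad_form r d x \<noteq> 0 \<and> is_sq (- quad_form r d x)})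
        + rat_of_nat (card {x \<in> carrier_vec r. quad_form r d x \<noteq> 0 \<and> \<not> is_sq (- quad_form r d x)})"
      unfolding of_nat_power[symmetric] card_quad_form_split[of r d] using sq_d[of r] r 3 by simp
    ultimately show ?thesis unfolding ind using 3 s r by auto
  next
    case 4
    have "card ?V = (if s = t then sq z t (r + 1) else 0)"
      unfolding V using card_border_type_same_rank[OF k, of d s] 4 d(3) sq_d[of "r + 1"] by simp
    then show ?thesis unfolding ind using 4 by auto
  next
    case 5
    then have "{w \<in> carrier_vec n. border_type n k d w = (r + 1, s)} = {}"
      by (auto simp: border_type_def split: if_splits)
    then have "card ?V = 0" unfolding V by (simp only: card.empty)
    then show ?thesis unfolding ind using 5 r by auto
  qed
qed

lemma sym0_Suc_eq_sum:
  assumes odd: "odd CARD('a::{field,finite})"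
  shows "sym0 TYPE('a) s (Suc n) m
    = (\<Sum>B \<in> hollow_sym n. card {v \<in> carrier_vec n. rank_char (Suc n) (border n (B :: 'a mat) v 0) m s})"
proof -
  let ?b = "\<lambda>(B :: 'a mat, v). border n B v 0"
  let ?S = "SIGMA B : hollow_sym n. {v \<in> carrier_vec n. rank_char (Suc n) (border n (B :: 'a mat) v 0) m s}"
  have bij: "bij_betw ?b (hollow_sym n \<times> carrier_vec n) (hollow_sym (Suc n))"
    by (rule hollow_sym_border_bij)
  have "{A \<in> hollow_sym (Suc n). rank_char (Suc n) (A :: 'a mat) m s} = ?b ` ?S"
    unfolding bij_betw_imp_surj_on[OF bij, symmetric] by force
  moreover have "inj_on ?b ?S"
    by (rule inj_on_subset[OF bij_betw_imp_inj_on[OF bij]]) auto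
  ultimately have "sym0 TYPE('a) s (Suc n) m = card ?S"
    unfolding sym0_eq_card_rank_char[OF odd] by (simp add: card_image)
  moreover have "card ?S = (\<Sum>B \<in> hollow_sym n. card {v \<in> carrier_vec n. rank_char (Suc n) (border n (B :: 'a mat) v 0) m s})"
    by (rule card_SigmaI[OF finite_hollow_sym]) simp
  ultimately show ?thesis by simp
qed

theorem corollary4p11:
  fixes z :: "'a::{field,finite}" and n r :: nat and s :: int
  assumes "odd CARD('a)"
    and "\<not> is_sq z"
    and "n \<ge> 1" and "r \<ge> 1"
    and "s \<in> {1, - 1}"
  shows "rat_of_nat (sym0 TYPE('a) s (n + 1) (r + 1)) =
      (rat_of_nat CARD('a) ^ n - rat_of_nat CARD('a) ^ (r - 1))
        * rat_of_nat (sym0 TYPE('a) (s * psi (- 1 :: 'a)) n (r - 1))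
    + rat_of_nat (sq z s (r + 1)) * rat_of_nat (sym0 TYPE('a) s n (r + 1))
    + 1 / 2 * (rat_of_nat (sq z s (r + 1)) - rat_of_nat (sq z s r))
        * rat_of_nat (sym0 TYPE('a) s n r)
    + (rat_of_nat CARD('a) ^ r
         - 1 / 2 * (rat_of_nat (sq z (- s) (r + 1)) + rat_of_nat (sq z (- s) r)))
        * rat_of_nat (sym0 TYPE('a) (- s) n r)"
proof -
  let ?H = "hollow_sym n :: 'a mat set"
  have count: "(\<Sum>B \<in> ?H. c * of_bool (rank_char n B l u)) = c * rat_of_nat (sym0 TYPE('a) u n l)"
    for c l u
  proof -
    have "?H \<inter> {B. rank_char n B l u} = {B \<in> ?H. rank_char n B l u}" by blast
    then show ?thesis
      unfolding sum_distrib_left[symmetric] sym0_eq_card_rank_char[OF assms(1)]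
      by (simp add: finite_hollow_sym)
  qed
  have "rat_of_nat (sym0 TYPE('a) s (n + 1) (r + 1)) =
    (\<Sum>B \<in> ?H. rat_of_nat (card {v \<in> carrier_vec n. rank_char (Suc n) (border n B v 0) (r + 1) s}))"
    using sym0_Suc_eq_sum[OF assms(1), of s n "r + 1"] by simp
  also have "\<dots> = (\<Sum>B \<in> ?H.
      (rat_of_nat CARD('a) ^ n - rat_of_nat CARD('a) ^ (r - 1))
        * of_bool (rank_char n B (r - 1) (s * psi (- 1 :: 'a)))
    + rat_of_nat (sq z s (r + 1)) * of_bool (rank_char n B (r + 1) s)
    + 1 / 2 * (rat_of_nat (sq z s (r + 1)) - rat_of_nat (sq z s r)) * of_bool (rank_char n B r s)
    + (rat_of_nat CARD('a) ^ r - 1 / 2 * (rat_of_nat (sq z (- s) (r + 1)) + rat_of_nat (sq z (- s) r)))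
        * of_bool (rank_char n B r (- s)))"
  proof (rule sum.cong[OF refl])
    fix B assume "B \<in> ?H"
    then obtain k t where "rank_char n B k t" using hollow_sym_rank_char_exists[OF assms(1)] by blast
    from card_hollow_extensions[OF assms(1,2,4,5) this]
    show "rat_of_nat (card {v \<in> carrier_vec n. rank_char (Suc n) (border n B v 0) (r + 1) s}) =
      (rat_of_nat CARD('a) ^ n - rat_of_nat CARD('a) ^ (r - 1))
        * of_bool (rank_char n B (r - 1) (s * psi (- 1 :: 'a)))
    + rat_of_nat (sq z s (r + 1)) * of_bool (rank_char n B (r + 1) s)
    + 1 / 2 * (rat_of_nat (sq z s (r + 1)) - rat_of_nat (sq z s r)) * of_bool (rank_char n B r s)
    + (rat_of_nat CARD('a) ^ r - 1 / 2 * (rat_of_nat (sq z (- s) (r + 1)) + rat_of_nat (sq z (- s) r)))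
        * of_bool (rank_char n B r (- s))" .
  qed
  finally show ?thesis unfolding sum.distrib count .
qed

end
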